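(* Let $n\ge1$ and let $g_1,\dots,g_n$ be unbounded convex mappings with angles at infinity $\pi\alpha_1,\dots,\pi\alpha_n$, where $(\alpha_1,\dots,\alpha_n)$ is chosen at random uniformly (with respect to Lebesgue measure) in the cube $[0,1]^n$ and, given these angles, the mappings are arbitrary. Then the probability that $g_1*\cdots*g_n$ is unbounded is equal to $1/n!$.
   Context: Let $\mathbb{D}$ be the open unit disk in $\mathbb{C}$. A convex mapping is a univalent (injective) holomorphic function on $\mathbb{D}$ whose range is a convex set; it is unbounded if its range is an unbounded set. For holomorphic functions $f(z)=\sum_{k\ge0}a_kz^k$ and $g(z)=\sum_{k\ge0}b_kz^k$ in $\mathbb{D}$, the convolution (Hadamard product) is $(f*g)(z)=\sum_{k\ge0}a_kb_kz^k$. The angle at infinity of an unbounded convex set is the infimum of the (opening) angles of all sectors containing that set, a sector being a planar region bounded by two rays issuing from a common vertex; the angle at infinity of an unbounded convex mapping is that of its image. It takes values in $[0,\pi]$. *)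

theory Defs
  imports "HOL-Complex_Analysis.Complex_Analysis" "HOL-Probability.Probability"
begin

definition convex_mapping :: "(complex \<Rightarrow> complex) \<Rightarrow> bool" where
  "convex_mapping f \<longleftrightarrow>
     f holomorphic_on ball 0 1 \<and> inj_on f (ball 0 1) \<and> convex (f ` ball 0 1)"

definition unbounded_on_disk :: "(complex \<Rightarrow> complex) \<Rightarrow> bool" where
  "unbounded_on_disk f \<longleftrightarrow> \<not> bounded (f ` ball 0 1)"

definition unbounded_convex_mapping :: "(complex \<Rightarrow> complex) \<Rightarrow> bool" where
  "unbounded_convex_mapping f \<longleftrightarrow> convex_mapping f \<and> unbounded_on_disk f"

(* Only meaningful for f, g holomorphic in the unit disk; the value outside the disk is junk. *)
definition hadamard :: "(complex \<Rightarrow> complex) \<Rightarrow> (complex \<Rightarrow> complex) \<Rightarrow> complex \<Rightarrow> complex" where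
  "hadamard f g = eval_fps
     (Abs_fps (\<lambda>k. fps_nth (fps_expansion f 0) k * fps_nth (fps_expansion g 0) k))"

(* g 1 * ... * g n, for n >= 1 *)
definition hadamard_upto :: "nat \<Rightarrow> (nat \<Rightarrow> complex \<Rightarrow> complex) \<Rightarrow> complex \<Rightarrow> complex" where
  "hadamard_upto n g = foldl hadamard (g 1) (map g [2..<Suc n])"

(* The closed region with vertex v between the rays with arguments \<phi> and \<phi> + \<theta>. *)
definition sector :: "complex \<Rightarrow> real \<Rightarrow> real \<Rightarrow> complex set" where
  "sector v \<phi> \<theta> = {v + of_real r * cis t | r t. 0 \<le> r \<and> \<phi> \<le> t \<and> t \<le> \<phi> + \<theta>}"

(* A convex set other than the whole plane lies in a half-plane, i.e. in a sector of
   opening angle pi, so the infimum is over a nonempty set.  The whole plane lies in no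
   sector, but it is not the image of the disk under a convex mapping. *)
definition angle_at_infinity :: "complex set \<Rightarrow> real" where
  "angle_at_infinity S = Inf {\<theta>. 0 < \<theta> \<and> \<theta> < 2 * pi \<and> (\<exists>v \<phi>. S \<subseteq> sector v \<phi> \<theta>)}"

definition mapping_angle_at_infinity :: "(complex \<Rightarrow> complex) \<Rightarrow> real" where
  "mapping_angle_at_infinity f = angle_at_infinity (f ` ball 0 1)"

definition uniform_cube :: "nat \<Rightarrow> (nat \<Rightarrow> real) measure" where
  "uniform_cube n =
     uniform_measure (Pi\<^sub>M {1..n} (\<lambda>_. lborel)) (Pi\<^sub>E {1..n} (\<lambda>_. {0..1}))"

end

theory Submission
  imports Defs
begin

text \<open>
  Put s = \<Sum> (1 - \<alpha> i).  Apart from a null set of parameters, all \<alpha> i lie strictly between 0 and 1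
  and s \<noteq> 1.  There the Hadamard product is unbounded if s < 1 and bounded if s > 1
  (\<open>hadamard_product_dichotomy\<close>).  In the coordinates 1 - \<alpha> i the event s < 1 is the open unit
  simplex, which has volume 1/n! (\<open>uniform_cube_deficit_sum\<close>).

  The dichotomy comes from the Taylor coefficients of a single convex mapping with angle at
  infinity \<pi>\<alpha>.  After rotations of the disc and of the image, and up to arbitrarily small errors
  \<epsilon>, the k-th coefficient has an argument of modulus at most \<pi>(1 - \<alpha>)/2 and a modulus comparable
  to k^(-(1 - \<alpha>)) (\<open>convex_mapping_coefficients\<close>).  In a product of such coefficients the arguments
  and the exponents add up.  If s > 1, the resulting series converges absolutely on the closed
  disc.  If s < 1, its coefficients lie in a sector of opening less than \<pi>, so that no cancellation
  takes place on a suitable radius, while the sum of their moduli diverges.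

  The coefficients are controlled in two stages.  The first is geometric.  The image of the
  mapping lies in a sector of opening slightly more than \<pi>\<alpha>, and it is invariant under
  translations by the vectors of a slightly smaller sector, because otherwise a separating line
  would force it into a sector that is too narrow (\<open>convex_mapping_normal_form\<close>).  Pulled back to
  the disc, these translations are self-maps with a common fixed point \<zeta> on the unit circle in
  the sense of Julia and Wolff.  Infinitesimally, and with \<zeta> rotated to 1, this says that
  Q(z) = (1 - z)^2 F'(z) takes its values in the dual sector of half-angle about \<pi>(1 - \<alpha>)/2
  (\<open>recession_imp_derivative_in_wedge\<close>).

  The second stage is analytic.  The k-th coefficient of F is a Fejer mean at the point 1 of the
  Taylor series of Q, and Fejer means are averages with respect to a positive kernel.  Hence the
  coefficient lies in the same sector as the values of Q.  Since the sector is narrower than a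
  half-plane, |Q| is comparable to Re Q, and Poisson's formula gives the upper bound.  The lower
  bound follows by applying the upper bound to 1/Q: by the Cauchy-Schwarz inequality the Fejer
  means of Q and of 1/Q have a product that is bounded below
  (\<open>wedge_derivative_coefficients\<close>).
\<close>

section \<open>Convex sets in sectors\<close>

text \<open>
  For 0 \<le> \<mu> \<le> \<pi> this is the closed sector of all w with |arg w| \<le> \<mu>.  Written as an inequality
  between Re w and |w| it is visibly closed under limits and, when cos \<mu> \<ge> 0, under addition
  and averaging, which is how it is used; arguments are only chosen where a product or a
  geometric picture needs them.
\<close>

definition wedge :: "real \<Rightarrow> complex set" where
  "wedge \<mu> = {w. cos \<mu> * cmod w \<le> Re w}"

lemma wedgeI_cis:
  assumes "0 \<le> r" "\<bar>t\<bar> \<le> \<mu>" "\<mu> \<le> pi"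
  shows "of_real r * cis t \<in> wedge \<mu>"
proof -
  have "cos \<mu> \<le> cos \<bar>t\<bar>"
    using assms by (intro cos_monotone_0_pi_le) auto
  then show ?thesis
    using assms by (auto simp: wedge_def norm_mult mult.commute intro!: mult_left_mono)
qed

lemma wedgeE_cis:
  assumes "w \<in> wedge \<mu>" "0 \<le> \<mu>" "\<mu> \<le> pi"
  obtains t where "\<bar>t\<bar> \<le> \<mu>" "w = of_real (cmod w) * cis t"
proof (cases "w = 0")
  case True
  then show ?thesis using that[of 0] assms by simp
next
  case False
  have w: "w = of_real (cmod w) * cis (Arg w)"
    using rcis_cmod_Arg[of w] by (simp add: rcis_def)
  have "Re w = cmod w * cos (Arg w)"
    by (subst w) simp
  then have "cmod w * cos \<mu> \<le> cmod w * cos \<bar>Arg w\<bar>"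
    using assms(1) by (simp add: wedge_def mult.commute)
  then have "cos \<mu> \<le> cos \<bar>Arg w\<bar>"
    using False by simp
  then have "\<bar>Arg w\<bar> \<le> \<mu>"
    using assms Arg_bounded[of w] by (subst (asm) cos_mono_le_eq) auto
  then show ?thesis using w that by blast
qed

lemma wedge_mono: "wedge \<mu> \<subseteq> wedge \<nu>" if "0 \<le> \<mu>" "\<mu> \<le> \<nu>" "\<nu> \<le> pi"
proof -
  have "cos \<nu> \<le> cos \<mu>" using that by (intro cos_monotone_0_pi_le) auto
  then show ?thesis
    by (auto simp: wedge_def intro: order_trans[OF mult_right_mono])
qed

lemma wedge_add:
  assumes "w \<in> wedge \<mu>" "z \<in> wedge \<mu>" "0 \<le> cos \<mu>"
  shows "w + z \<in> wedge \<mu>"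
proof -
  have "cos \<mu> * cmod (w + z) \<le> cos \<mu> * (cmod w + cmod z)"
    using assms by (intro mult_left_mono norm_triangle_ineq)
  then show ?thesis using assms by (simp add: wedge_def algebra_simps)
qed

lemma wedge_scaleR: "w \<in> wedge \<mu> \<Longrightarrow> 0 \<le> r \<Longrightarrow> of_real r * w \<in> wedge \<mu>"
  using mult_left_mono[of "cos \<mu> * cmod w" "Re w" r]
  by (simp add: wedge_def norm_mult mult.left_commute)

text \<open>
  1 / w is a positive multiple of the conjugate of w, and the wedge is symmetric about the
  real axis.
\<close>

lemma inverse_in_wedge: "w \<in> wedge \<mu> \<Longrightarrow> inverse w \<in> wedge \<mu>"
proof (cases "w = 0")
  case False
  assume "w \<in> wedge \<mu>"
  then have "of_real (inverse ((cmod w)\<^sup>2)) * w \<in> wedge \<mu>"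
    by (rule wedge_scaleR) simp
  moreover have "of_real (inverse ((cmod w)\<^sup>2)) * w = inverse (cnj w)"
    using False complex_norm_square[of w] by (simp add: field_simps)
  ultimately have "cnj (inverse w) \<in> wedge \<mu>"
    by simp
  then show ?thesis
    unfolding wedge_def by (simp only: mem_Collect_eq complex_mod_cnj cnj.sel)
qed (simp add: wedge_def)

text \<open>
  If the argument of u had modulus above \<pi>/2 - \<mu>, the edge direction of the wedge on the
  opposite side of the real axis would make an obtuse angle with u.
\<close>

lemma dual_wedge:
  assumes "u \<noteq> 0" "0 < \<mu>" "\<mu> < pi / 2"
    and dual: "\<And>w. w \<in> wedge \<mu> \<Longrightarrow> 0 \<le> Re (w / u)"
  shows "u \<in> wedge (pi / 2 - \<mu>)"
proof -
  define t where "t = Arg u"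
  have u: "u = of_real (cmod u) * cis t"
    using rcis_cmod_Arg[of u] by (simp add: rcis_def t_def)
  have t: "-pi < t" "t \<le> pi" using Arg_bounded[of u] by (auto simp: t_def)
  have pair: "0 \<le> cos (s - t)" if "\<bar>s\<bar> \<le> \<mu>" for s
  proof -
    have "cis s \<in> wedge \<mu>" using wedgeI_cis[of 1 s \<mu>] that assms by simp
    from dual[OF this] have "0 \<le> Re (cis s / (of_real (cmod u) * cis t))"
      using u by simp
    also have "cis s / (of_real (cmod u) * cis t) = of_real (1 / cmod u) * cis (s - t)"
      using assms by (simp add: cis_divide[symmetric] field_simps)
    finally show ?thesis using assms by (simp add: zero_le_divide_iff)
  qed
  have "\<bar>t\<bar> \<le> pi / 2 - \<mu>"
  proof (rule ccontr)
    assume neg: "\<not> ?thesis"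
    have "cos (\<mu> + \<bar>t\<bar>) < 0"
    proof -
      have "cos (\<mu> + \<bar>t\<bar>) = - cos (\<mu> + \<bar>t\<bar> - pi)" by simp
      moreover have "0 < cos (\<mu> + \<bar>t\<bar> - pi)"
        using neg t assms by (intro cos_gt_zero_pi) auto
      ultimately show ?thesis by linarith
    qed
    moreover have "0 \<le> cos (\<mu> + \<bar>t\<bar>)"
      using pair[of "\<mu>"] pair[of "-\<mu>"] assms cos_minus[of "\<mu> + t"] by (cases "t \<ge> 0") auto
    ultimately show False by linarith
  qed
  then show ?thesis
    using wedgeI_cis[of "cmod u" t "pi / 2 - \<mu>"] u assms by simp
qed

text \<open>
  Below opening \<pi> a sector is the intersection of two half-planes; this makes membership a
  matter of two linear inequalities.
\<close>

lemma in_sectorI: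
  assumes "0 < \<theta>" "\<theta> < pi"
    and "0 \<le> Im (cis (- \<phi>) * (y - v))" "Im (cis (- \<phi> - \<theta>) * (y - v)) \<le> 0"
  shows "y \<in> sector v \<phi> \<theta>"
proof -
  define u where "u = cis (- \<phi>) * (y - v)"
  define t where "t = Arg u"
  have u: "u = of_real (cmod u) * cis t"
    using rcis_cmod_Arg[of u] by (simp add: rcis_def t_def)
  have t: "-pi < t" "t \<le> pi" using Arg_bounded[of u] by (auto simp: t_def)
  have y: "y = v + of_real (cmod u) * cis (\<phi> + t)"
  proof -
    have "of_real (cmod u) * cis (\<phi> + t) = cis \<phi> * u"
      by (subst (2) u) (simp add: cis_mult[symmetric])
    also have "\<dots> = y - v" by (simp add: u_def cis_mult mult.assoc[symmetric])
    finally show ?thesis by simp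
  qed
  show ?thesis
  proof (cases "u = 0")
    case True
    then have "y = v + of_real 0 * cis \<phi>" using y by simp
    then show ?thesis unfolding sector_def using assms by force
  next
    case False
    have "Im u = cmod u * sin t" by (subst u) simp
    with assms(3) False have s1: "0 \<le> sin t"
      by (simp add: u_def[symmetric] zero_le_mult_iff)
    have "cis (- \<phi> - \<theta>) * (y - v) = cis (-\<theta>) * u"
      by (simp add: u_def cis_mult mult.assoc[symmetric] add.commute)
    also have "\<dots> = of_real (cmod u) * cis (t - \<theta>)"
      by (subst u) (simp only: mult.left_commute[of "cis _"] cis_mult uminus_add_conv_diff)
    finally have "cmod u * sin (t - \<theta>) \<le> 0" using assms(4) by simp
    with False have s2: "sin (t - \<theta>) \<le> 0" by (simp add: mult_le_0_iff)
    have "0 \<le> t" using s1 t sin_gt_zero[of "-t"] by (cases "t < 0") auto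
    moreover have "t \<le> \<theta>"
      using s2 t assms sin_gt_zero[of "t - \<theta>"] by (cases "t > \<theta>") auto
    ultimately show ?thesis unfolding sector_def using y by force
  qed
qed

lemma halfplane_subset_sector:
  assumes "a \<noteq> 0"
  shows "\<exists>v \<phi>. {y. b \<le> a \<bullet> y} \<subseteq> sector v \<phi> pi"
proof -
  define t where "t = Arg a"
  have a: "a = of_real (cmod a) * cis t"
    using rcis_cmod_Arg[of a] by (simp add: rcis_def t_def)
  define v where "v = (b / (cmod a)\<^sup>2) *\<^sub>R a"
  have av: "a \<bullet> v = b"
    using assms by (simp add: v_def power2_norm_eq_inner)
  have "y \<in> sector v (t - pi / 2) pi" if "b \<le> a \<bullet> y" for y
  proof -
    define u where "u = y - v"
    have au: "0 \<le> a \<bullet> u" using that av by (simp add: u_def inner_diff_right)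
    define w where "w = cis (pi / 2 - t) * u"
    have w: "w = of_real (cmod w) * cis (Arg w)"
      using rcis_cmod_Arg[of w] by (simp add: rcis_def)
    have uw: "u = cis (t - pi / 2) * w" by (simp add: w_def cis_mult mult.assoc[symmetric])
    have "a \<bullet> u = cmod a * (cos t * Re u + sin t * Im u)"
      by (subst (1) a) (simp add: inner_complex_def algebra_simps)
    also have "cos t * Re u + sin t * Im u = Im w"
      by (simp add: w_def cos_diff sin_diff)
    finally have "a \<bullet> u = cmod a * Im w" .
    then have "0 \<le> Im w" using au assms by (simp add: zero_le_mult_iff)
    then have "0 \<le> Arg w" "Arg w \<le> pi" using Arg_bounded[of w] by (auto simp: Arg_less_0 leI)
    moreover have "y = v + of_real (cmod w) * cis (t - pi / 2 + Arg w)"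
    proof -
      have "y = v + cis (t - pi / 2) * w" using uw by (simp add: u_def diff_eq_eq add.commute)
      also have "\<dots> = v + of_real (cmod w) * (cis (t - pi / 2) * cis (Arg w))"
        by (subst w) (simp only: mult.left_commute)
      finally show ?thesis by (simp only: cis_mult)
    qed
    ultimately show ?thesis unfolding sector_def by force
  qed
  then show ?thesis by blast
qed


text \<open>
  The functionals y \<mapsto> Re (cis (-t) y) that are bounded below on S form a convex cone.  It
  contains the given direction t and the direction \<pi>/2 - \<kappa>, the inner normal of one edge of
  the wedge; as these are less than \<pi> apart, it contains \<pi>/2 - \<mu>, which lies between them.
  The half-plane with that normal and the other edge of the wedge cut out a sector of
  opening \<mu> + \<kappa>.
\<close>

lemma halfplane_and_wedge_subset_sector:
  assumes S: "S \<subseteq> wedge \<kappa>" "\<And>y. y \<in> S \<Longrightarrow> d \<le> Re (cis (- t) * y)"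
    and "0 \<le> \<mu>" "\<mu> < \<kappa>" "\<kappa> < pi / 2" and t: "pi / 2 - \<mu> \<le> t" "t \<le> pi"
  shows "\<exists>v. S \<subseteq> sector v (- \<mu>) (\<mu> + \<kappa>)"
proof -
  define t0 where "t0 = pi / 2 - \<kappa>"
  have pos: "0 < sin (t - t0)" "0 \<le> sin (t - (pi / 2 - \<mu>))" "0 \<le> sin (\<kappa> - \<mu>)" "0 < sin (\<mu> + \<kappa>)"
    using assms by (auto simp: t0_def intro!: sin_gt_zero sin_ge_zero)
  define s where "s = sin (\<kappa> - \<mu>) * d / (sin (t - t0) * sin (\<mu> + \<kappa>))"
  have "y \<in> sector (of_real s * cis \<kappa>) (- \<mu>) (\<mu> + \<kappa>)" if y: "y \<in> S" for y
  proof (rule in_sectorI)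
    obtain r where r: "\<bar>r\<bar> \<le> \<kappa>" "y = of_real (cmod y) * cis r"
      using wedgeE_cis[of y \<kappa>] y S assms by auto
    have "Re (cis (- t0) * y) = cmod y * cos (r - t0)"
      by (subst r(2)) (simp add: cos_diff algebra_simps)
    moreover have "0 \<le> cos (r - t0)"
      using r assms by (intro cos_ge_zero) (auto simp: t0_def)
    ultimately have 1: "0 \<le> Re (cis (- t0) * y)" by simp
    have "Im (cis (- \<kappa>) * y) = cmod y * - sin (\<kappa> - r)"
      by (subst r(2)) (simp add: sin_diff algebra_simps)
    moreover have "0 \<le> sin (\<kappa> - r)"
      using r assms by (intro sin_ge_zero) auto
    ultimately have 2: "Im (cis (- \<kappa>) * y) \<le> 0" by (simp add: mult_nonneg_nonpos)
    \<comment> \<open>The direction pi/2 - mu as a positive combination of t and t0; Im (cis mu * y) is the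
      functional with normal pi/2 - mu.\<close>
    have "sin (t - t0) * Im (cis \<mu> * y)
        = sin (\<kappa> - \<mu>) * Re (cis (- t) * y) + sin (t - (pi / 2 - \<mu>)) * Re (cis (- t0) * y)"
      by (simp add: t0_def sin_diff cos_diff sin_add cos_add algebra_simps)
    also have "\<dots> \<ge> sin (\<kappa> - \<mu>) * d + 0"
      using S(2)[OF y] 1 pos by (intro add_mono mult_left_mono mult_nonneg_nonneg) auto
    finally have "sin (\<kappa> - \<mu>) * d / sin (t - t0) \<le> Im (cis \<mu> * y)"
      using pos by (simp add: field_simps)
    moreover have "Im (cis \<mu> * (of_real s * cis \<kappa>)) = s * sin (\<mu> + \<kappa>)"
      by (simp add: sin_add algebra_simps)
    moreover have "s * sin (\<mu> + \<kappa>) = sin (\<kappa> - \<mu>) * d / sin (t - t0)"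
      using pos by (simp add: s_def)
    ultimately show "0 \<le> Im (cis (- (- \<mu>)) * (y - of_real s * cis \<kappa>))"
      by (simp add: right_diff_distrib)
    have "Im (cis (- \<kappa>) * (of_real s * cis \<kappa>)) = 0"
      by (simp add: algebra_simps)
    with 2 show "Im (cis (- (- \<mu>) - (\<mu> + \<kappa>)) * (y - of_real s * cis \<kappa>)) \<le> 0"
      by (simp add: right_diff_distrib)
  qed (use assms in auto)
  then show ?thesis by blast
qed

lemma cnj_in_sector: "cnj y \<in> sector v \<phi> \<theta> \<Longrightarrow> y \<in> sector (cnj v) (- \<phi> - \<theta>) \<theta>"
proof -
  assume "cnj y \<in> sector v \<phi> \<theta>"
  then obtain r t where *: "cnj y = v + of_real r * cis t" "0 \<le> r" "\<phi> \<le> t" "t \<le> \<phi> + \<theta>"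
    unfolding sector_def by blast
  have "y = cnj (v + of_real r * cis t)" using *(1) by (metis complex_cnj_cnj)
  also have "\<dots> = cnj v + of_real r * cis (- t)" by (simp add: cis_cnj)
  finally show ?thesis unfolding sector_def using * by force
qed

text \<open>
  If a translate of S along the narrower wedge left S, a separating line would give a
  half-plane around S whose inner normal makes an angle of at least \<pi>/2 - \<mu> with the positive
  real axis, and then S would fit into a sector of opening \<mu> + \<kappa> < \<alpha>.
\<close>

lemma wedge_recession:
  assumes "convex S" and S: "S \<subseteq> wedge \<kappa>"
    and wide: "\<And>v \<phi> \<theta>. S \<subseteq> sector v \<phi> \<theta> \<Longrightarrow> 0 < \<theta> \<Longrightarrow> \<theta> < pi \<Longrightarrow> \<alpha> \<le> \<theta>"
    and ang: "0 \<le> \<mu>" "\<mu> < \<kappa>" "\<kappa> < pi / 2" "\<mu> + \<kappa> < \<alpha>"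
    and x: "x \<in> S" "w \<in> wedge \<mu>"
  shows "x + w \<in> S"
proof (rule ccontr)
  assume "x + w \<notin> S"
  then obtain a b where a: "a \<noteq> 0" "a \<bullet> (x + w) \<le> b" "\<And>y. y \<in> S \<Longrightarrow> b \<le> a \<bullet> y"
    using separating_hyperplane_set_point_inaff[OF \<open>convex S\<close> _ \<open>x + w \<notin> S\<close>] x
    by (metis empty_iff)
  obtain e where e: "\<bar>e\<bar> \<le> \<mu>" "w = of_real (cmod w) * cis e"
    using wedgeE_cis[OF x(2)] ang by auto
  have "w \<noteq> 0" using x \<open>x + w \<notin> S\<close> by auto
  define t where "t = Arg a"
  have a': "a = of_real (cmod a) * cis t"
    using rcis_cmod_Arg[of a] by (simp add: rcis_def t_def)
  have t: "-pi < t" "t \<le> pi" using Arg_bounded[of a] by (auto simp: t_def)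
  have inner: "a \<bullet> y = cmod a * Re (cis (- t) * y)" for y
    by (subst (1) a') (simp add: inner_complex_def algebra_simps)
  have "a \<bullet> w \<le> 0" using a(2) a(3)[OF x(1)] by (simp add: inner_add_right)
  then have "cmod a * (cmod w * cos (e - t)) \<le> 0"
    unfolding inner by (subst (asm) e(2)) (simp add: cos_diff algebra_simps)
  then have cos: "cos (e - t) \<le> 0"
    using \<open>a \<noteq> 0\<close> \<open>w \<noteq> 0\<close> by (simp add: mult_le_0_iff)
  have t': "pi / 2 - \<mu> \<le> \<bar>t\<bar>"
  proof (rule ccontr)
    assume "\<not> ?thesis"
    then have "0 < cos (e - t)" using e by (intro cos_gt_zero_pi) auto
    with cos show False by simp
  qed
  have lower: "b / cmod a \<le> Re (cis (- t) * y)" if "y \<in> S" for y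
    using a(3)[OF that] a(1) unfolding inner by (simp add: field_simps)
  obtain v \<phi> where "S \<subseteq> sector v \<phi> (\<mu> + \<kappa>)"
  proof (cases "0 \<le> t")
    case True
    with halfplane_and_wedge_subset_sector[OF S lower] ang t t' that show ?thesis by auto
  next
    case False
    have "cnj ` S \<subseteq> wedge \<kappa>" using S by (auto simp: wedge_def)
    moreover have "b / cmod a \<le> Re (cis (- (- t)) * y)" if "y \<in> cnj ` S" for y
      using lower that by auto
    ultimately obtain v where v: "cnj ` S \<subseteq> sector v (- \<mu>) (\<mu> + \<kappa>)"
      using halfplane_and_wedge_subset_sector[of "cnj ` S" \<kappa> "b / cmod a" "-t" \<mu>] ang t t' False by auto
    then have "S \<subseteq> sector (cnj v) (\<mu> - (\<mu> + \<kappa>)) (\<mu> + \<kappa>)"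
      using cnj_in_sector[of _ v "-\<mu>" "\<mu> + \<kappa>"] by auto
    with that show ?thesis by blast
  qed
  from wide[OF this] show False using ang by auto
qed

text \<open>
  Otherwise the inverse mapping would be a bounded entire function.  This guarantees that some
  sector contains the image, so that the infimum defining the angle at infinity is taken over
  a nonempty set.
\<close>

lemma convex_mapping_image_neq_UNIV:
  assumes "convex_mapping f"
  shows "f ` ball 0 1 \<noteq> UNIV"
proof
  assume U: "f ` ball 0 1 = UNIV"
  have f: "f holomorphic_on ball 0 1" "inj_on f (ball 0 1)"
    using assms by (auto simp: convex_mapping_def)
  from holomorphic_has_inverse[OF f(1) open_ball f(2)]
  obtain g where g: "g holomorphic_on UNIV" "\<And>z. z \<in> ball 0 1 \<Longrightarrow> g (f z) = z"
    unfolding U by metis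
  have "range g \<subseteq> ball 0 1" using g(2) U by (metis UNIV_I image_iff image_subsetI)
  then have "bounded (range g)" using bounded_ball bounded_subset by blast
  from Liouville_theorem[OF g(1) this] obtain c where "\<And>z. g z = c"
    by (auto simp: constant_on_def)
  then have "0 = c" "1 / 2 = c" using g(2)[of 0] g(2)[of "1 / 2"] by auto
  then show False by auto
qed

text \<open>
  A nearly optimal sector containing the image, moved to have its vertex at 0 and its axis on
  the positive real axis, gives the outer wedge.  Since no sector containing the image is
  narrower than \<pi>\<alpha>, the preceding lemma makes the slightly smaller wedge a set of
  translations under which the image is invariant.
\<close>

lemma convex_mapping_normal_form:
  assumes f: "convex_mapping f"
    and angle: "mapping_angle_at_infinity f = pi * \<alpha>"
    and \<alpha>: "0 < \<epsilon>" "\<epsilon> < \<alpha>" "\<alpha> + \<epsilon> < 1"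
  obtains c v where "cmod c = 1"
    "\<And>z. z \<in> ball 0 1 \<Longrightarrow> c * (f z - v) \<in> wedge (pi * (\<alpha> + \<epsilon>) / 2)"
    "\<And>z w. z \<in> ball 0 1 \<Longrightarrow> w \<in> wedge (pi * (\<alpha> - \<epsilon>) / 2) \<Longrightarrow>
       c * (f z - v) + w \<in> (\<lambda>z. c * (f z - v)) ` ball 0 1"
proof -
  define \<Omega> where "\<Omega> = f ` ball 0 1"
  define X where "X = {\<theta>. 0 < \<theta> \<and> \<theta> < 2 * pi \<and> (\<exists>v \<phi>. \<Omega> \<subseteq> sector v \<phi> \<theta>)}"
  have cvx: "convex \<Omega>" using f by (simp add: convex_mapping_def \<Omega>_def)
  obtain p where "p \<notin> \<Omega>" using convex_mapping_image_neq_UNIV[OF f] by (auto simp: \<Omega>_def)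
  moreover have "\<Omega> \<noteq> {}" by (simp add: \<Omega>_def)
  ultimately obtain a b where "a \<noteq> 0" "\<And>y. y \<in> \<Omega> \<Longrightarrow> b \<le> a \<bullet> y"
    using separating_hyperplane_set_point_inaff[OF cvx] by metis
  then have "\<exists>v \<phi>. \<Omega> \<subseteq> sector v \<phi> pi"
    using halfplane_subset_sector[of a b] by fastforce
  then have "pi \<in> X" by (simp add: X_def)
  then have "X \<noteq> {}" by blast
  have Inf: "Inf X = pi * \<alpha>"
    using angle by (simp add: mapping_angle_at_infinity_def angle_at_infinity_def X_def \<Omega>_def)
  have lower: "pi * \<alpha> \<le> \<theta>" if "\<theta> \<in> X" for \<theta>
    unfolding Inf[symmetric] using that by (intro cInf_lower bdd_belowI[of _ 0]) (auto simp: X_def)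
  have "Inf X < pi * (\<alpha> + \<epsilon> / 2)"
    using \<alpha> by (simp add: Inf)
  from cInf_lessD[OF \<open>X \<noteq> {}\<close> this] obtain \<theta> where "\<theta> \<in> X" and \<theta>: "\<theta> < pi * (\<alpha> + \<epsilon> / 2)"
    by blast
  then obtain v \<phi> where v: "\<Omega> \<subseteq> sector v \<phi> \<theta>" by (auto simp: X_def)
  define \<psi> where "\<psi> = \<phi> + \<theta> / 2"
  define c where "c = cis (- \<psi>)"
  define S where "S = (\<lambda>y. c * (y - v)) ` \<Omega>"
  have \<theta>': "pi * \<alpha> \<le> \<theta>" using lower \<open>\<theta> \<in> X\<close> .
  have pi: "pi * \<alpha> + pi * \<epsilon> < pi" using \<alpha> by (simp add: distrib_left[symmetric])
  have pos: "0 < pi * \<alpha>" "0 < pi * \<epsilon>" "pi * \<epsilon> < pi * \<alpha>" using \<alpha> by auto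
  have \<theta>'': "\<theta> < pi * \<alpha> + pi * \<epsilon> / 2" using \<theta> by (simp add: distrib_left)
  have \<theta>2: "\<theta> / 2 < pi / 2" "0 < \<theta> / 2"
    using \<theta>'' pi pos \<theta>' by linarith+
  have S_wedge: "S \<subseteq> wedge (\<theta> / 2)"
  proof
    fix s assume "s \<in> S"
    then obtain r t where *: "s = c * (of_real r * cis t)" "0 \<le> r" "\<phi> \<le> t" "t \<le> \<phi> + \<theta>"
      using v by (fastforce simp: S_def sector_def)
    have "s = of_real r * cis (t - \<psi>)"
      using * by (simp add: c_def mult.left_commute[of "cis _"] cis_mult)
    moreover have "of_real r * cis (t - \<psi>) \<in> wedge (\<theta> / 2)"
    proof (rule wedgeI_cis)
      show "\<bar>t - \<psi>\<bar> \<le> \<theta> / 2"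
        unfolding \<psi>_def using *(3,4) by linarith
    qed (use * \<theta>2 in auto)
    ultimately show "s \<in> wedge (\<theta> / 2)" by simp
  qed
  have wide: "pi * \<alpha> \<le> \<theta>1" if sub: "S \<subseteq> sector v1 \<phi>1 \<theta>1" and "0 < \<theta>1" "\<theta>1 < pi" for v1 \<phi>1 \<theta>1
  proof -
    have "\<Omega> \<subseteq> sector (v + cis \<psi> * v1) (\<phi>1 + \<psi>) \<theta>1"
    proof
      fix y assume "y \<in> \<Omega>"
      then obtain r t where *: "c * (y - v) = v1 + of_real r * cis t" "0 \<le> r" "\<phi>1 \<le> t" "t \<le> \<phi>1 + \<theta>1"
        using sub by (fastforce simp: S_def sector_def)
      have "y = v + cis \<psi> * (c * (y - v))" by (simp add: c_def cis_mult mult.assoc[symmetric])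
      also have "\<dots> = v + cis \<psi> * v1 + of_real r * cis (t + \<psi>)"
        unfolding *(1) by (simp add: cis_mult[symmetric] algebra_simps)
      finally show "y \<in> sector (v + cis \<psi> * v1) (\<phi>1 + \<psi>) \<theta>1"
        unfolding sector_def using * by force
    qed
    then have "\<theta>1 \<in> X" using that by (auto simp: X_def)
    then show ?thesis by (rule lower)
  qed
  have "c * (f z - v) \<in> wedge (pi * (\<alpha> + \<epsilon>) / 2)" if "z \<in> ball 0 1" for z
  proof -
    have "c * (f z - v) \<in> wedge (\<theta> / 2)" using S_wedge that unfolding S_def \<Omega>_def by blast
    moreover have "wedge (\<theta> / 2) \<subseteq> wedge (pi * (\<alpha> + \<epsilon>) / 2)"
      using \<theta>2 \<theta> pi pos by (intro wedge_mono) (auto simp: distrib_left)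
    ultimately show ?thesis by blast
  qed
  moreover have "x + w \<in> S" if "x \<in> S" "w \<in> wedge (pi * (\<alpha> - \<epsilon>) / 2)" for x w
  proof (rule wedge_recession[OF _ S_wedge wide])
    have "convex ((\<lambda>y. c * y) ` (\<lambda>y. - v + y) ` \<Omega>)"
      by (intro convex_linear_image convex_translation cvx linear_times)
    then show "convex S" by (simp add: S_def image_image algebra_simps)
    show "pi * (\<alpha> - \<epsilon>) / 2 + \<theta> / 2 < pi * \<alpha>" "pi * (\<alpha> - \<epsilon>) / 2 < \<theta> / 2" "0 \<le> pi * (\<alpha> - \<epsilon>) / 2"
    proof -
      have "(A - E) / 2 + \<theta> / 2 < A \<and> (A - E) / 2 < \<theta> / 2 \<and> 0 \<le> (A - E) / 2"
        if "\<theta> < A + E / 2" "A \<le> \<theta>" "0 < E" "E < A" for A E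
        using that by (auto simp: field_simps)
      from this[OF \<theta>'' \<theta>' pos(2,3)]
      show "pi * (\<alpha> - \<epsilon>) / 2 + \<theta> / 2 < pi * \<alpha>" "pi * (\<alpha> - \<epsilon>) / 2 < \<theta> / 2" "0 \<le> pi * (\<alpha> - \<epsilon>) / 2"
        unfolding right_diff_distrib by blast+
    qed
  qed (use that \<theta>2 in auto)
  ultimately show ?thesis
    using that[of c v] by (simp add: S_def \<Omega>_def image_image c_def)
qed

section \<open>Translation-invariant images and the Julia-Wolff lemma\<close>

lemma norm_one_minus_cnj_mult_pos:
  assumes "cmod a < 1" "cmod b \<le> 1"
  shows "0 < cmod (1 - cnj b * a)"
proof -
  have "cmod (cnj b * a) \<le> cmod a"
    using assms mult_right_mono[of "cmod b" 1 "cmod a"] by (simp add: norm_mult)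
  with assms have "cnj b * a \<noteq> 1" by force
  then show ?thesis by simp
qed

text \<open>
  This form of the pseudo-hyperbolic distance isolates the factors 1 - |a|^2 and 1 - |b|^2, one of
  which can be divided out when its point tends to the boundary.
\<close>

lemma one_minus_Moebius_norm_sq:
  assumes "cmod a < 1" "cmod b < 1"
  shows "1 - (cmod (Moebius_function 0 b a))\<^sup>2
    = (1 - (cmod a)\<^sup>2) * (1 - (cmod b)\<^sup>2) / (cmod (1 - cnj b * a))\<^sup>2"
proof -
  have "(cmod (1 - cnj b * a))\<^sup>2 - (cmod (a - b))\<^sup>2 = (1 - (cmod a)\<^sup>2) * (1 - (cmod b)\<^sup>2)"
    unfolding cmod_power2 by (simp add: power2_eq_square algebra_simps)
  then show ?thesis
    using norm_one_minus_cnj_mult_pos[of a b] assms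
    by (simp add: Moebius_function_simple norm_divide power_divide diff_divide_distrib[symmetric] field_simps)
qed

text \<open>
  Moving b and \<phi>(b) to the origin by disc automorphisms reduces this to the Schwarz lemma.
\<close>

theorem Schwarz_Pick:
  assumes hol: "\<phi> holomorphic_on ball 0 1" and \<phi>: "\<And>z. cmod z < 1 \<Longrightarrow> cmod (\<phi> z) < 1"
    and ab: "cmod a < 1" "cmod b < 1"
  shows "cmod (Moebius_function 0 (\<phi> b) (\<phi> a)) \<le> cmod (Moebius_function 0 b a)"
proof -
  define h where "h = Moebius_function 0 (\<phi> b) \<circ> (\<phi> \<circ> Moebius_function 0 (- b))"
  note \<phi>b = \<phi>[OF ab(2)]
  have M: "Moebius_function 0 (- b) ` ball 0 1 \<subseteq> ball 0 1"
    using ab Moebius_function_norm_lt_1[of "-b"] by auto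
  have "h holomorphic_on ball 0 1"
    unfolding h_def
    by (intro holomorphic_on_compose_gen[OF holomorphic_on_compose_gen[OF Moebius_function_holomorphic hol M]
          Moebius_function_holomorphic]) (use ab \<phi>b M \<phi> in auto)
  moreover have "h 0 = 0"
    by (simp add: h_def Moebius_function_of_zero Moebius_function_eq_zero)
  moreover have "cmod (h z) < 1" if "cmod z < 1" for z
    unfolding h_def o_def
    by (intro Moebius_function_norm_lt_1 \<phi>b \<phi>) (use that ab in auto)
  moreover have "cmod (Moebius_function 0 b a) < 1"
    using ab by (intro Moebius_function_norm_lt_1)
  ultimately have "cmod (h (Moebius_function 0 b a)) \<le> cmod (Moebius_function 0 b a)"
    by (rule Schwarz_Lemma(1))
  then show ?thesis
    using Moebius_function_compose[of "-b" b a] ab by (simp add: h_def)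
qed

text \<open>
  Points at small pseudo-hyperbolic distance \<eta> are close to each other, and their distances to
  the unit circle agree up to a factor tending to 1 with \<eta>.
\<close>

lemma one_minus_norm_sq_comparison:
  assumes ab: "cmod a < 1" "cmod b < 1" and \<eta>: "cmod (Moebius_function 0 a b) \<le> \<eta>" "\<eta> < 1"
  shows "1 - (cmod b)\<^sup>2 \<le> (1 - (cmod a)\<^sup>2) * (1 + 2 * \<eta> / (1 - \<eta>))"
    and "cmod (b - a) \<le> 2 * \<eta>"
proof -
  define D where "D = cmod (1 - cnj a * b)"
  have D: "0 < D" using norm_one_minus_cnj_mult_pos[of b a] ab by (simp add: D_def)
  have dist: "cmod (b - a) \<le> \<eta> * D"
    using \<eta>(1) D by (simp add: Moebius_function_simple norm_divide flip: D_def) (simp add: field_simps)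
  have \<eta>0: "0 \<le> \<eta>" using \<eta>(1) norm_ge_zero order_trans by blast
  have "1 - cnj a * b = of_real (1 - (cmod a)\<^sup>2) + cnj a * (a - b)"
    using complex_norm_square[of a] by (simp add: algebra_simps)
  then have "D \<le> (1 - (cmod a)\<^sup>2) + cmod a * cmod (a - b)"
    using norm_triangle_ineq[of "of_real (1 - (cmod a)\<^sup>2)" "cnj a * (a - b)"] ab
    by (simp add: D_def norm_mult abs_square_le_1 del: of_real_diff)
  also have "cmod a * cmod (a - b) \<le> 1 * (\<eta> * D)"
    using dist ab by (intro mult_mono) (auto simp: norm_minus_commute)
  finally have DD: "(1 - \<eta>) * D \<le> 1 - (cmod a)\<^sup>2" by (simp add: algebra_simps)
  have "D \<le> 2"
    using norm_triangle_ineq4[of 1 "cnj a * b"] mult_mono[of "cmod a" 1 "cmod b" 1] ab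
    by (simp add: D_def norm_mult)
  with \<eta>0 dist mult_left_mono[of D 2 \<eta>] show "cmod (b - a) \<le> 2 * \<eta>" by simp
  have "(cmod a)\<^sup>2 - (cmod b)\<^sup>2 = (cmod a - cmod b) * (cmod a + cmod b)"
    by (simp add: power2_eq_square algebra_simps)
  also have "\<dots> \<le> cmod (b - a) * 2"
    using ab norm_triangle_ineq2[of a b] by (intro mult_mono) (auto simp: norm_minus_commute)
  also have "\<dots> \<le> \<eta> * D * 2" using dist by simp
  also have "\<dots> \<le> \<eta> * ((1 - (cmod a)\<^sup>2) / (1 - \<eta>)) * 2"
    using DD \<eta> \<eta>0 by (intro mult_right_mono mult_left_mono) (auto simp: pos_le_divide_eq mult.commute)
  finally show "1 - (cmod b)\<^sup>2 \<le> (1 - (cmod a)\<^sup>2) * (1 + 2 * \<eta> / (1 - \<eta>))"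
    by (simp add: algebra_simps)
qed

text \<open>
  A wedge contains discs around the points of the positive axis with radius proportional to
  the distance from the vertex.
\<close>

lemma ball_subset_wedge:
  assumes "0 \<le> cos \<mu>" "0 \<le> r" "cmod u \<le> (1 - cos \<mu>) / (1 + cos \<mu>) * r"
  shows "of_real r + u \<in> wedge \<mu>"
proof -
  have "(1 + cos \<mu>) * cmod u \<le> (1 - cos \<mu>) * r"
    using assms by (simp add: field_simps)
  moreover have "cos \<mu> * cmod (of_real r + u) \<le> cos \<mu> * (r + cmod u)"
    using assms norm_triangle_ineq[of "of_real r" u] by (intro mult_left_mono) auto
  moreover have "- cmod u \<le> Re u" using abs_Re_le_cmod[of u] by linarith
  ultimately show ?thesis by (simp add: wedge_def algebra_simps)
qed

text \<open>
  This is the Julia-Wolff lemma for the self-maps F\<inverse>(F + w) of the disc, with one boundary point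
  \<zeta> serving all w: the Poisson kernel at \<zeta> does not decrease along them.  The points
  p n = F\<inverse>(F 0 + n) accumulate at some \<zeta> on the circle.  The image contains discs around F (p n)
  with radii growing linearly in n, so translating by a fixed w moves p n by a
  pseudo-hyperbolic distance tending to 0.  Schwarz-Pick for the pair z, p n then turns in the
  limit into the inequality for Poisson kernels.
\<close>

lemma recession_fixes_boundary_point:
  fixes F :: "complex \<Rightarrow> complex"
  assumes F: "F holomorphic_on ball 0 1" "inj_on F (ball 0 1)"
    and \<mu>: "0 < \<mu>" "\<mu> < pi / 2"
    and rec: "\<And>x w. x \<in> F ` ball 0 1 \<Longrightarrow> w \<in> wedge \<mu> \<Longrightarrow> x + w \<in> F ` ball 0 1"
  obtains \<zeta> where "cmod \<zeta> = 1"
    "\<And>z z' w. z \<in> ball 0 1 \<Longrightarrow> z' \<in> ball 0 1 \<Longrightarrow> w \<in> wedge \<mu> \<Longrightarrow> F z' = F z + w \<Longrightarrow>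
       (1 - (cmod z)\<^sup>2) / (cmod (1 - cnj \<zeta> * z))\<^sup>2 \<le> (1 - (cmod z')\<^sup>2) / (cmod (1 - cnj \<zeta> * z'))\<^sup>2"
proof -
  define S where "S = F ` ball 0 1"
  obtain G where G: "G holomorphic_on S" "\<And>z. z \<in> ball 0 1 \<Longrightarrow> G (F z) = z"
    using holomorphic_has_inverse[OF F(1) open_ball F(2)] unfolding S_def by metis
  have GS: "G x \<in> ball 0 1" "F (G x) = x" if "x \<in> S" for x
    using that G(2) by (auto simp: S_def)
  have rec': "x + w \<in> S" if "x \<in> S" "w \<in> wedge \<mu>" for x w
    using rec that by (simp add: S_def)
  have F0: "F 0 \<in> S" by (simp add: S_def)
  have c\<mu>: "0 < cos \<mu>" "cos \<mu> < 1"
    using \<mu> cos_gt_zero cos_monotone_0_pi[of 0 \<mu>] by auto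
  define d where "d = (1 - cos \<mu>) / (1 + cos \<mu>)"
  have d: "0 < d" using c\<mu> by (simp add: d_def)
  have far: "F 0 + of_nat n + u \<in> S" if "cmod u \<le> d * real n" for n u
    using rec'[OF F0 ball_subset_wedge[of \<mu> "real n" u]] that c\<mu> by (simp add: d_def add.assoc)
  define p where "p n = G (F 0 + of_nat n)" for n :: nat
  have nS: "F 0 + of_nat n \<in> S" for n using far[of 0 n] d by simp
  have p: "cmod (p n) < 1" "F (p n) = F 0 + of_nat n" for n
    using GS[OF nS[of n]] by (auto simp: p_def)
  have "\<forall>n. p n \<in> cball 0 1" using p by (simp add: less_imp_le)
  then obtain \<zeta> k where "\<zeta> \<in> cball 0 1" and k: "strict_mono (k :: nat \<Rightarrow> nat)"
    and lim: "(p \<circ> k) \<longlonglongrightarrow> \<zeta>"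
    using compact_cball[of "0::complex" 1] unfolding compact_def by blast
  have k_ge: "n \<le> k n" for n using k by (rule seq_suble)
  have "\<not> cmod \<zeta> < 1"
  proof
    assume "cmod \<zeta> < 1"
    then have "isCont F \<zeta>"
      using holomorphic_on_imp_continuous_on[OF F(1)] by (simp add: continuous_on_eq_continuous_at)
    then have "(\<lambda>n. F ((p \<circ> k) n)) \<longlonglongrightarrow> F \<zeta>"
      using lim by (rule isCont_tendsto_compose)
    then have "Bseq (\<lambda>n. F 0 + of_nat (k n))"
      by (simp add: p convergentI convergent_imp_Bseq)
    then obtain K where K: "\<And>n. cmod (F 0 + of_nat (k n)) \<le> K"
      by (auto simp: Bseq_def)
    define n where "n = nat \<lceil>K + cmod (F 0)\<rceil> + 1"
    have "real n \<le> real (k n)" using k_ge by simp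
    also have "\<dots> \<le> cmod (F 0 + of_nat (k n)) + cmod (F 0)"
      using norm_triangle_ineq4[of "F 0 + of_nat (k n)" "F 0"] by simp
    also have "\<dots> \<le> K + cmod (F 0)" using K[of n] by simp
    finally show False by (simp add: n_def) linarith
  qed
  with \<open>\<zeta> \<in> cball 0 1\<close> have \<zeta>: "cmod \<zeta> = 1" by simp
  show ?thesis
  proof (rule that[OF \<zeta>])
    fix z z' w
    assume z: "z \<in> ball 0 1" and z': "z' \<in> ball 0 1" and w: "w \<in> wedge \<mu>" and Fz': "F z' = F z + w"
    define \<phi> where "\<phi> x = G (F x + w)" for x
    have \<phi>S: "F x + w \<in> S" if "x \<in> ball 0 1" for x using rec' w that by (simp add: S_def)
    have \<phi>_hol: "\<phi> holomorphic_on ball 0 1"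
      unfolding \<phi>_def
      by (rule holomorphic_on_compose_gen[of "\<lambda>x. F x + w" _ G S, unfolded o_def])
         (use F G \<phi>S in \<open>auto intro!: holomorphic_intros\<close>)
    have \<phi>_ball: "cmod (\<phi> x) < 1" if "cmod x < 1" for x
      using \<phi>S[of x] GS(1) that by (auto simp: \<phi>_def)
    have \<phi>z: "\<phi> z = z'" using G(2)[OF z'] by (simp add: \<phi>_def Fz')
    define a where "a n = p (k n)" for n
    define b where "b n = \<phi> (a n)" for n
    have a1: "cmod (a n) < 1" for n by (simp add: a_def p)
    have b1: "cmod (b n) < 1" for n using \<phi>_ball a1 by (simp add: b_def)
    define \<eta> where "\<eta> n = cmod w / (d * real (k n))" for n
    have "filterlim k sequentially sequentially" using k by (rule filterlim_subseq)
    then have "filterlim (\<lambda>n. d * real (k n)) at_top sequentially"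
      by (intro filterlim_tendsto_pos_mult_at_top[OF tendsto_const] d)
         (rule filterlim_compose[OF filterlim_real_sequentially])
    then have \<eta>0: "\<eta> \<longlonglongrightarrow> 0"
      unfolding \<eta>_def by (rule real_tendsto_divide_at_top[OF tendsto_const])
    have \<eta>1: "eventually (\<lambda>n. \<eta> n < 1) sequentially"
      using order_tendstoD(2)[OF \<eta>0, of 1] by simp
    have Mob: "eventually (\<lambda>n. cmod (Moebius_function 0 (a n) (b n)) \<le> \<eta> n) sequentially"
      using \<eta>1 eventually_gt_at_top[of 0]
    proof eventually_elim
      case (elim n)
      define R where "R = d * real (k n)"
      have R: "0 < R" using elim k_ge[of n] d by (simp add: R_def)
      have wR: "cmod w < R" using elim R by (simp add: \<eta>_def R_def[symmetric])
      define \<psi> where "\<psi> x = G (F 0 + of_nat (k n) + of_real R * x)" for x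
      have \<psi>S: "F 0 + of_nat (k n) + of_real R * x \<in> S" if "cmod x < 1" for x
        using that R by (intro far) (simp add: norm_mult R_def[symmetric] mult_le_cancel_left1 less_imp_le)
      \<comment> \<open>Schwarz-Pick for the inverse of F on the disc of radius R around F (p (k n)).\<close>
      have "\<psi> holomorphic_on ball 0 1"
        unfolding \<psi>_def
        by (rule holomorphic_on_compose_gen[of "\<lambda>x. F 0 + of_nat (k n) + of_real R * x" _ G S, unfolded o_def])
           (use G \<psi>S in \<open>auto intro!: holomorphic_intros\<close>)
      moreover have "cmod (\<psi> x) < 1" if "cmod x < 1" for x
        using \<psi>S[OF that] GS(1) by (auto simp: \<psi>_def)
      ultimately have "cmod (Moebius_function 0 (\<psi> 0) (\<psi> (w / of_real R)))
            \<le> cmod (Moebius_function 0 0 (w / of_real R))"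
        using wR R by (intro Schwarz_Pick) (auto simp: norm_divide)
      moreover have "\<psi> 0 = a n" by (simp add: \<psi>_def a_def p_def)
      moreover have "\<psi> (w / of_real R) = b n" using R by (simp add: \<psi>_def b_def \<phi>_def a_def p)
      ultimately show ?case
        using R by (simp add: Moebius_function_simple norm_divide \<eta>_def R_def[symmetric])
    qed
    have a_lim: "a \<longlonglongrightarrow> \<zeta>" using lim by (simp add: a_def[abs_def] o_def)
    have "(\<lambda>n. b n - a n) \<longlonglongrightarrow> 0"
    proof (rule Lim_null_comparison)
      show "eventually (\<lambda>n. cmod (b n - a n) \<le> 2 * \<eta> n) sequentially"
        using Mob \<eta>1 by eventually_elim (use a1 b1 one_minus_norm_sq_comparison in blast)
      show "(\<lambda>n. 2 * \<eta> n) \<longlonglongrightarrow> 0" using tendsto_mult_right_zero[OF \<eta>0] .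
    qed
    from tendsto_add[OF this a_lim] have b_lim: "b \<longlonglongrightarrow> \<zeta>" by simp
    have nz: "cmod (1 - cnj \<zeta> * z) \<noteq> 0" "cmod (1 - cnj \<zeta> * z') \<noteq> 0"
      using norm_one_minus_cnj_mult_pos[of z \<zeta>] norm_one_minus_cnj_mult_pos[of z' \<zeta>] z z' \<zeta> by auto
    show "(1 - (cmod z)\<^sup>2) / (cmod (1 - cnj \<zeta> * z))\<^sup>2 \<le> (1 - (cmod z')\<^sup>2) / (cmod (1 - cnj \<zeta> * z'))\<^sup>2"
    proof (rule tendsto_le[OF sequentially_bot])
      show "(\<lambda>n. (1 - (cmod z)\<^sup>2) / (cmod (1 - cnj (a n) * z))\<^sup>2)
          \<longlonglongrightarrow> (1 - (cmod z)\<^sup>2) / (cmod (1 - cnj \<zeta> * z))\<^sup>2"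
        using nz a_lim by (intro tendsto_intros) auto
      have "(\<lambda>n. (1 - (cmod z')\<^sup>2) / (cmod (1 - cnj (b n) * z'))\<^sup>2 * (1 + 2 * \<eta> n / (1 - \<eta> n)))
          \<longlonglongrightarrow> (1 - (cmod z')\<^sup>2) / (cmod (1 - cnj \<zeta> * z'))\<^sup>2 * (1 + 2 * 0 / (1 - 0))"
        using nz b_lim \<eta>0 by (intro tendsto_intros) auto
      then show "(\<lambda>n. (1 - (cmod z')\<^sup>2) / (cmod (1 - cnj (b n) * z'))\<^sup>2 * (1 + 2 * \<eta> n / (1 - \<eta> n)))
          \<longlonglongrightarrow> (1 - (cmod z')\<^sup>2) / (cmod (1 - cnj \<zeta> * z'))\<^sup>2" by simp
      show "eventually (\<lambda>n. (1 - (cmod z)\<^sup>2) / (cmod (1 - cnj (a n) * z))\<^sup>2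
          \<le> (1 - (cmod z')\<^sup>2) / (cmod (1 - cnj (b n) * z'))\<^sup>2 * (1 + 2 * \<eta> n / (1 - \<eta> n))) sequentially"
        using Mob \<eta>1
      proof eventually_elim
        case (elim n)
        have x: "0 < 1 - (cmod (a n))\<^sup>2"
          using a1[of n] by (simp add: abs_square_less_1)
        have P': "0 \<le> (1 - (cmod z')\<^sup>2) / (cmod (1 - cnj (b n) * z'))\<^sup>2"
          using z' by (simp add: abs_square_le_1)
        have "(cmod (Moebius_function 0 (b n) z'))\<^sup>2 \<le> (cmod (Moebius_function 0 (a n) z))\<^sup>2"
          using Schwarz_Pick[OF \<phi>_hol \<phi>_ball, of z "a n"] z a1[of n]
          by (intro power_mono) (auto simp: \<phi>z b_def)
        then have "1 - (cmod (Moebius_function 0 (a n) z))\<^sup>2 \<le> 1 - (cmod (Moebius_function 0 (b n) z'))\<^sup>2"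
          by simp
        then have "(1 - (cmod z)\<^sup>2) / (cmod (1 - cnj (a n) * z))\<^sup>2 * (1 - (cmod (a n))\<^sup>2)
           \<le> (1 - (cmod z')\<^sup>2) / (cmod (1 - cnj (b n) * z'))\<^sup>2 * (1 - (cmod (b n))\<^sup>2)"
          using z z' a1[of n] b1[of n]
          by (subst (asm) (1 2) one_minus_Moebius_norm_sq) (simp_all only: mem_ball_0 times_divide_eq_left)
        also have "\<dots> \<le> (1 - (cmod z')\<^sup>2) / (cmod (1 - cnj (b n) * z'))\<^sup>2
            * ((1 - (cmod (a n))\<^sup>2) * (1 + 2 * \<eta> n / (1 - \<eta> n)))"
          using one_minus_norm_sq_comparison(1)[OF a1 b1 elim] P' by (intro mult_left_mono)
        finally have "(1 - (cmod z)\<^sup>2) / (cmod (1 - cnj (a n) * z))\<^sup>2 * (1 - (cmod (a n))\<^sup>2)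
           \<le> (1 - (cmod z')\<^sup>2) / (cmod (1 - cnj (b n) * z'))\<^sup>2 * (1 + 2 * \<eta> n / (1 - \<eta> n))
              * (1 - (cmod (a n))\<^sup>2)" by (simp only: mult_ac)
        then show ?case by (rule mult_right_le_imp_le[OF _ x])
      qed
    qed
  qed
qed

text \<open>
  The Poisson kernel as the real part of a holomorphic function, so that it can be
  differentiated along the translations.
\<close>

lemma Re_Cayley:
  assumes "cmod \<zeta> = 1"
  shows "Re ((1 + cnj \<zeta> * z) / (1 - cnj \<zeta> * z)) = (1 - (cmod z)\<^sup>2) / (cmod (1 - cnj \<zeta> * z))\<^sup>2"
proof -
  have "Re ((1 + w) / (1 - w)) = (1 - (cmod w)\<^sup>2) / (cmod (1 - w))\<^sup>2" for w
    by (simp add: Re_divide cmod_power2) (simp add: power2_eq_square algebra_simps)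
  from this[of "cnj \<zeta> * z"] show ?thesis using assms by (simp add: norm_mult)
qed

text \<open>
  In the coordinate of the image, the real part of the Cayley transform at \<zeta> is nondecreasing in
  every direction w of the wedge.  Its derivative in direction w is 2 Re (w / u) with
  u = \<zeta> (1 - z / \<zeta>)^2 F'(z), so u lies in the dual wedge.
\<close>

lemma recession_imp_derivative_in_wedge:
  fixes F :: "complex \<Rightarrow> complex"
  assumes F: "F holomorphic_on ball 0 1" "inj_on F (ball 0 1)"
    and \<mu>: "0 < \<mu>" "\<mu> < pi / 2"
    and rec: "\<And>x w. x \<in> F ` ball 0 1 \<Longrightarrow> w \<in> wedge \<mu> \<Longrightarrow> x + w \<in> F ` ball 0 1"
  obtains \<zeta> where "cmod \<zeta> = 1"
    "\<And>z. z \<in> ball 0 1 \<Longrightarrow> \<zeta> * (1 - cnj \<zeta> * z)\<^sup>2 * deriv F z \<in> wedge (pi / 2 - \<mu>)"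
proof -
  obtain \<zeta> where \<zeta>: "cmod \<zeta> = 1"
    and Julia: "\<And>z z' w. z \<in> ball 0 1 \<Longrightarrow> z' \<in> ball 0 1 \<Longrightarrow> w \<in> wedge \<mu> \<Longrightarrow> F z' = F z + w \<Longrightarrow>
       (1 - (cmod z)\<^sup>2) / (cmod (1 - cnj \<zeta> * z))\<^sup>2 \<le> (1 - (cmod z')\<^sup>2) / (cmod (1 - cnj \<zeta> * z'))\<^sup>2"
    using recession_fixes_boundary_point[OF F \<mu> rec] by metis
  have "\<zeta> * (1 - cnj \<zeta> * z)\<^sup>2 * deriv F z \<in> wedge (pi / 2 - \<mu>)" if z: "z \<in> ball 0 1" for z
  proof (rule dual_wedge)
    obtain G where G: "G holomorphic_on F ` ball 0 1"
      "\<And>z. z \<in> ball 0 1 \<Longrightarrow> deriv F z * deriv G (F z) = 1" "\<And>z. z \<in> ball 0 1 \<Longrightarrow> G (F z) = z"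
      using holomorphic_has_inverse[OF F(1) open_ball F(2)] by metis
    have "\<zeta> \<noteq> 0" using \<zeta> by auto
    have nz: "1 - cnj \<zeta> * z \<noteq> 0" using norm_one_minus_cnj_mult_pos[of z \<zeta>] z \<zeta> by auto
    have F'nz: "deriv F z \<noteq> 0" using G(2)[OF z] by auto
    show "\<zeta> * (1 - cnj \<zeta> * z)\<^sup>2 * deriv F z \<noteq> 0" using \<open>\<zeta> \<noteq> 0\<close> nz F'nz by simp
    have openS: "open (F ` ball 0 1)" using open_mapping_thm3[OF F(1) open_ball F(2)] .
    define C where "C x = (1 + cnj \<zeta> * x) / (1 - cnj \<zeta> * x)" for x
    have C': "(C has_field_derivative 2 * cnj \<zeta> / (1 - cnj \<zeta> * z)\<^sup>2) (at z)"
      unfolding C_def using nz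
      by (auto intro!: derivative_eq_intros simp: power2_eq_square field_simps)
    have G': "(G has_field_derivative inverse (deriv F z)) (at (F z))"
    proof -
      have "deriv G (F z) = inverse (deriv F z)"
        using inverse_unique[OF G(2)[OF z]] by simp
      then show ?thesis
        using holomorphic_derivI[OF G(1) openS, of "F z"] z by simp
    qed
    fix w assume w: "w \<in> wedge \<mu>"
    define h where "h t = Re (C (G (F z + of_real t * w)))" for t :: real
    have line: "((\<lambda>t. F z + of_real t * w) has_vector_derivative w) (at 0)"
      by (auto intro!: derivative_eq_intros simp: has_vector_derivative_def scaleR_conv_of_real)
    have "((\<lambda>x. C (G x)) has_field_derivative 2 * cnj \<zeta> / (1 - cnj \<zeta> * z)\<^sup>2 * inverse (deriv F z)) (at (F z))"
      by (rule DERIV_chain2[OF _ G']) (use C' G(3)[OF z] in simp)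
    then have "((\<lambda>t. C (G (F z + of_real t * w))) has_vector_derivative
        (w * (2 * cnj \<zeta> / (1 - cnj \<zeta> * z)\<^sup>2 * inverse (deriv F z)))) (at 0)"
      using field_vector_diff_chain_at[OF line, of "\<lambda>x. C (G x)"
          "2 * cnj \<zeta> / (1 - cnj \<zeta> * z)\<^sup>2 * inverse (deriv F z)"] by (simp add: o_def)
    then have h': "(h has_real_derivative
        Re (w * (2 * cnj \<zeta> / (1 - cnj \<zeta> * z)\<^sup>2 * inverse (deriv F z)))) (at 0)"
      unfolding h_def has_real_derivative_iff_has_vector_derivative
      by (rule bounded_linear.has_vector_derivative[OF bounded_linear_Re])
    have mono: "h 0 \<le> h t" if t: "0 < t" for t
    proof -
      have tw: "of_real t * w \<in> wedge \<mu>" using w t by (intro wedge_scaleR) auto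
      then have "F z + of_real t * w \<in> F ` ball 0 1" using rec z by blast
      then obtain z' where z': "z' \<in> ball 0 1" "F z + of_real t * w = F z'" by auto
      from Julia[OF z z'(1) tw z'(2)[symmetric]] show ?thesis
        using G(3)[OF z'(1)] G(3)[OF z] by (simp add: h_def z'(2) C_def Re_Cayley[OF \<zeta>])
    qed
    have "0 \<le> Re (w * (2 * cnj \<zeta> / (1 - cnj \<zeta> * z)\<^sup>2 * inverse (deriv F z)))"
    proof (rule ccontr)
      assume "\<not> ?thesis"
      then obtain e where "e > 0" "\<And>t. 0 < t \<Longrightarrow> t < e \<Longrightarrow> h (0 + t) < h 0"
        using DERIV_neg_dec_right[OF h'] by auto
      from this(2)[of "e / 2"] \<open>e > 0\<close> mono[of "e / 2"] show False by simp
    qed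
    also have "w * (2 * cnj \<zeta> / (1 - cnj \<zeta> * z)\<^sup>2 * inverse (deriv F z))
       = of_real 2 * (w / (\<zeta> * (1 - cnj \<zeta> * z)\<^sup>2 * deriv F z))"
    proof -
      have "cnj \<zeta> = inverse \<zeta>"
        using \<zeta> complex_norm_square[of \<zeta>] \<open>\<zeta> \<noteq> 0\<close> by (simp add: field_simps)
      then show ?thesis by (simp add: divide_inverse mult_ac)
    qed
    finally have "0 \<le> Re (of_real 2 * (w / (\<zeta> * (1 - cnj \<zeta> * z)\<^sup>2 * deriv F z)))" .
    moreover have "Re (of_real 2 * X) = 2 * Re X" for X by simp
    ultimately show "0 \<le> Re (w / (\<zeta> * (1 - cnj \<zeta> * z)\<^sup>2 * deriv F z))"
      by (simp only: zero_le_mult_iff) simp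
  qed (use \<mu> in auto)
  with \<zeta> that show ?thesis by blast
qed

section \<open>Coefficients of functions with values in a sector\<close>

text \<open>
  The map (p - p 0) / (p + cnj (p 0)) sends the disc to itself and fixes 0; solving the Schwarz
  inequality for |p| gives the bound.
\<close>

lemma positive_real_part_growth:
  assumes p: "p holomorphic_on ball 0 1" and pos: "\<And>z. cmod z < 1 \<Longrightarrow> 0 < Re (p z)" and z: "cmod z < 1"
  shows "cmod (p z) \<le> 2 * cmod (p 0) / (1 - cmod z)"
proof -
  have nz: "p z + cnj (p 0) \<noteq> 0" if "cmod z < 1" for z
  proof
    assume "p z + cnj (p 0) = 0"
    then have "Re (p z) + Re (p 0) = 0" by (simp add: complex_eq_iff)
    then show False using pos[OF that] pos[of 0] by simp
  qed
  define m where "m z = (p z - p 0) / (p z + cnj (p 0))" for z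
  have "m holomorphic_on ball 0 1"
    unfolding m_def using nz by (intro holomorphic_intros p) auto
  moreover have "m 0 = 0" by (simp add: m_def)
  moreover have "cmod (m z) < 1" if "cmod z < 1" for z
  proof -
    have "(cmod (p z + cnj (p 0)))\<^sup>2 - (cmod (p z - p 0))\<^sup>2 = 4 * (Re (p z) * Re (p 0))"
      unfolding cmod_power2 by (simp add: power2_eq_square algebra_simps)
    also have "\<dots> > 0" using pos[OF that] pos[of 0] by simp
    finally have "cmod (p z - p 0) < cmod (p z + cnj (p 0))"
      using power2_less_imp_less[of "cmod (p z - p 0)" "cmod (p z + cnj (p 0))"] by simp
    then show ?thesis using nz[OF that] by (simp add: m_def norm_divide)
  qed
  ultimately have "cmod (m z) \<le> cmod z" using z by (rule Schwarz_Lemma(1))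
  then have "cmod (p z - p 0) \<le> cmod z * cmod (p z + cnj (p 0))"
    using nz[OF z] by (simp add: m_def norm_divide field_simps)
  also have "\<dots> \<le> cmod z * (cmod (p z) + cmod (p 0))"
    using norm_triangle_ineq[of "p z" "cnj (p 0)"] by (intro mult_left_mono) auto
  finally have "cmod (p z) - cmod (p 0) \<le> cmod z * (cmod (p z) + cmod (p 0))"
    using norm_triangle_ineq2[of "p z" "p 0"] by linarith
  moreover have "cmod z * cmod (p 0) \<le> 1 * cmod (p 0)"
    using z by (intro mult_right_mono) auto
  ultimately have "(1 - cmod z) * cmod (p z) \<le> 2 * cmod (p 0)" by (simp add: algebra_simps)
  then show ?thesis using z by (simp add: field_simps)
qed

text \<open>
  The power h^(1/\<sigma>) has positive real part, because \<kappa> / \<sigma> < \<pi>/2, and therefore grows at most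
  like 1 / (1 - |z|).
\<close>

lemma wedge_valued_growth:
  assumes h: "h holomorphic_on ball 0 1" "\<And>z. cmod z < 1 \<Longrightarrow> h z \<noteq> 0" "\<And>z. cmod z < 1 \<Longrightarrow> h z \<in> wedge \<kappa>"
    and \<kappa>: "0 < \<kappa>" "\<kappa> < pi / 2" "2 * \<kappa> / pi < \<sigma>"
  obtains C where "0 < C" "\<And>z. cmod z < 1 \<Longrightarrow> cmod (h z) \<le> C * (1 - cmod z) powr (- \<sigma>)"
proof -
  have \<sigma>: "0 < \<sigma>" using \<kappa> by (meson divide_pos_pos mult_pos_pos order_less_trans pi_gt_zero zero_less_numeral)
  have "0 < cos \<kappa>" using \<kappa> by (intro cos_gt_zero) auto
  have hpos: "0 < Re (h z)" if "cmod z < 1" for z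
    using h(2)[OF that] h(3)[OF that] \<open>0 < cos \<kappa>\<close>
    by (auto simp: wedge_def intro: less_le_trans[of 0 "cos \<kappa> * cmod (h z)"])
  define p where "p z = exp (of_real (1 / \<sigma>) * Ln (h z))" for z
  have "p holomorphic_on ball 0 1"
    unfolding p_def
  proof (intro holomorphic_intros h(1))
    show "h z \<notin> \<real>\<^sub>\<le>\<^sub>0" if "z \<in> ball 0 1" for z
      using hpos[of z] that by (auto simp: complex_nonpos_Reals_iff)
  qed
  moreover have "0 < Re (p z)" if z: "cmod z < 1" for z
  proof -
    obtain t where t: "\<bar>t\<bar> \<le> \<kappa>" "h z = of_real (cmod (h z)) * cis t"
      using wedgeE_cis[OF h(3)[OF z]] \<kappa> by auto
    have "Im (Ln (h z)) = t"
      using t \<kappa> h(2)[OF z] Arg_unique[of "cmod (h z)" t "h z"] by (simp add: Arg_eq_Im_Ln cis_conv_exp)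
    moreover have "\<bar>t / \<sigma>\<bar> < pi / 2"
    proof -
      have "\<kappa> < \<sigma> * (pi / 2)" using \<kappa> by (simp add: field_simps)
      then have "\<bar>t\<bar> < \<sigma> * (pi / 2)" using t by linarith
      then show ?thesis using \<sigma> by (simp add: field_simps)
    qed
    then have "0 < cos (t / \<sigma>)" unfolding abs_less_iff by (intro cos_gt_zero_pi) linarith+
    ultimately show ?thesis by (simp add: p_def Re_exp)
  qed
  ultimately have bound: "cmod (p z) \<le> 2 * cmod (p 0) / (1 - cmod z)" if "cmod z < 1" for z
    using positive_real_part_growth that by blast
  have "cmod (h z) \<le> (2 * cmod (p 0)) powr \<sigma> * (1 - cmod z) powr (- \<sigma>)" if z: "cmod z < 1" for z
  proof -
    have "cmod (p z) = cmod (h z) powr (1 / \<sigma>)"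
      using h(2)[OF z] by (simp add: p_def powr_def)
    then have "cmod (h z) = cmod (p z) powr \<sigma>"
      using \<sigma> h(2)[OF z] by (simp add: powr_powr)
    also have "\<dots> \<le> (2 * cmod (p 0) / (1 - cmod z)) powr \<sigma>"
      using bound[OF z] \<sigma> by (intro powr_mono2) auto
    also have "\<dots> = (2 * cmod (p 0)) powr \<sigma> * (1 - cmod z) powr (- \<sigma>)"
      using z by (simp add: powr_divide powr_minus_divide)
    finally show ?thesis .
  qed
  moreover have "0 < (2 * cmod (p 0)) powr \<sigma>" by (simp add: p_def)
  ultimately show ?thesis using that by blast
qed

abbreviation circle_point :: "real \<Rightarrow> real \<Rightarrow> complex" where
  "circle_point \<rho> t \<equiv> of_real \<rho> * cis (2 * pi * t)"

lemma circlepath_0_eq: "circlepath 0 \<rho> t = circle_point \<rho> t"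
  by (simp add: circlepath cis_conv_exp mult_ac)

lemma has_contour_integral_circlepath_0:
  assumes "(f has_contour_integral I) (circlepath 0 \<rho>)"
  shows "((\<lambda>t. f (circle_point \<rho> t) * circle_point \<rho> t) has_integral I / (2 * pi * \<i>)) {0..1}"
proof -
  have "((\<lambda>t. f (circlepath 0 \<rho> t) * vector_derivative (circlepath 0 \<rho>) (at t within {0..1})) has_integral I) {0..1}"
    using assms by (simp add: has_contour_integral_def)
  then have "((\<lambda>t. f (circle_point \<rho> t) * circle_point \<rho> t * (2 * pi * \<i>)) has_integral I) {0..1}"
    by (rule has_integral_eq[rotated])
       (simp add: vector_derivative_circlepath01 circlepath_0_eq, simp add: cis_conv_exp mult_ac)
  from has_integral_divide[OF this, of "2 * pi * \<i>"] show ?thesis by simp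
qed

lemma circle_mean_coeff:
  assumes g: "g holomorphic_on ball 0 1" and \<rho>: "0 < \<rho>" "\<rho> < 1"
  shows "((\<lambda>t. g (circle_point \<rho> t) * cis (- (2 * pi * t) * real k)) has_integral
            of_real \<rho> ^ k * fps_nth (fps_expansion g 0) k) {0..1}"
proof -
  have "((\<lambda>u. g u / (u - 0) ^ Suc k) has_contour_integral 2 * pi * \<i> / fact k * (deriv ^^ k) g 0) (circlepath 0 \<rho>)"
    using \<rho> by (intro Cauchy_has_contour_integral_higher_derivative_circlepath
        holomorphic_on_imp_continuous_on holomorphic_on_subset[OF g]) auto
  from has_contour_integral_circlepath_0[OF this]
  have "((\<lambda>t. g (circle_point \<rho> t) / circle_point \<rho> t ^ Suc k * circle_point \<rho> t)
      has_integral fps_nth (fps_expansion g 0) k) {0..1}"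
    by (simp add: fps_expansion_def)
  from has_integral_mult_right[OF this, of "of_real \<rho> ^ k"]
  show ?thesis
  proof (rule has_integral_eq[rotated])
    fix t :: real
    have "cis (2 * pi * t) ^ k * cis (- (2 * pi * t) * real k) = 1"
      unfolding Complex.DeMoivre cis_mult by simp
    then have "cis (- (2 * pi * t) * real k) = 1 / cis (2 * pi * t) ^ k"
      by (simp add: field_simps)
    then show "of_real \<rho> ^ k * (g (circle_point \<rho> t) / circle_point \<rho> t ^ Suc k * circle_point \<rho> t)
        = g (circle_point \<rho> t) * cis (- (2 * pi * t) * real k)"
      using \<rho> by (simp add: power_mult_distrib)
  qed
qed

lemma circle_mean_positive_frequency:
  assumes g: "g holomorphic_on ball 0 1" and \<rho>: "0 < \<rho>" "\<rho> < 1" and "0 < m"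
  shows "((\<lambda>t. g (circle_point \<rho> t) * cis (2 * pi * t * real m)) has_integral 0) {0..1}"
proof -
  have "(\<lambda>z. z ^ m * g z) holomorphic_on ball 0 1" by (intro holomorphic_intros g)
  from circle_mean_coeff[OF this \<rho>, of 0]
  have "((\<lambda>t. circle_point \<rho> t ^ m * g (circle_point \<rho> t)) has_integral 0) {0..1}"
    by (simp add: fps_expansion_def zero_power[OF \<open>0 < m\<close>])
  from has_integral_mult_right[OF this, of "1 / of_real \<rho> ^ m"]
  show ?thesis
    using \<rho> by (simp add: power_mult_distrib Complex.DeMoivre mult_ac)
qed

text \<open>
  On |u| = \<rho> one has u - \<rho>^2 = u (1 - cnj u), so the integrand is the Cauchy kernel at the
  interior point \<rho>^2 for the function g(u) / (1 - u).
\<close>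

lemma circle_mean_Poisson:
  assumes g: "g holomorphic_on ball 0 1" and \<rho>: "0 < \<rho>" "\<rho> < 1"
  shows "((\<lambda>t. g (circle_point \<rho> t) / of_real ((cmod (1 - circle_point \<rho> t))\<^sup>2)) has_integral
            g (of_real (\<rho>\<^sup>2)) / of_real (1 - \<rho>\<^sup>2)) {0..1}"
proof -
  have \<rho>2: "\<rho>\<^sup>2 < \<rho>" using \<rho> by (simp add: power2_eq_square)
  have "(\<lambda>u. g u / (1 - u)) holomorphic_on cball 0 \<rho>"
    using \<rho> by (intro holomorphic_intros holomorphic_on_subset[OF g]) auto
  from Cauchy_integral_circlepath_simple[OF this, of "of_real (\<rho>\<^sup>2)"] \<rho>2
  have "((\<lambda>u. g u / (1 - u) / (u - of_real (\<rho>\<^sup>2))) has_contour_integral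
      2 * pi * \<i> * (g (of_real (\<rho>\<^sup>2)) / (1 - of_real (\<rho>\<^sup>2)))) (circlepath 0 \<rho>)"
    by (simp add: norm_power)
  from has_contour_integral_circlepath_0[OF this]
  have "((\<lambda>t. g (circle_point \<rho> t) / (1 - circle_point \<rho> t) / (circle_point \<rho> t - of_real (\<rho>\<^sup>2)) * circle_point \<rho> t)
     has_integral g (of_real (\<rho>\<^sup>2)) / of_real (1 - \<rho>\<^sup>2)) {0..1}"
    by simp
  then show ?thesis
  proof (rule has_integral_eq[rotated])
    fix t :: real
    define u where "u = circle_point \<rho> t"
    have u: "cmod u = \<rho>" using \<rho> by (simp add: u_def norm_mult)
    then have "u \<noteq> 0" "1 - u \<noteq> 0" using \<rho> by auto
    have "u - of_real (\<rho>\<^sup>2) = u * cnj (1 - u)"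
      using complex_norm_square[of u] u by (simp add: algebra_simps)
    moreover have "complex_of_real ((cmod (1 - u))\<^sup>2) = (1 - u) * cnj (1 - u)"
      using complex_norm_square[of "1 - u"] by simp
    ultimately have "g u / (1 - u) / (u - of_real (\<rho>\<^sup>2)) * u = g u / of_real ((cmod (1 - u))\<^sup>2)"
      using \<open>u \<noteq> 0\<close> \<open>1 - u \<noteq> 0\<close> by simp
    then show "g (circle_point \<rho> t) / (1 - circle_point \<rho> t) / (circle_point \<rho> t - of_real (\<rho>\<^sup>2)) * circle_point \<rho> t
       = g (circle_point \<rho> t) / of_real ((cmod (1 - circle_point \<rho> t))\<^sup>2)"
      by (simp add: u_def)
  qed
qed

text \<open>
  For a function with values in a wedge narrower than a half-plane the real part controls the
  modulus pointwise, hence also in the mean.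
\<close>

lemma wedge_mean:
  assumes \<phi>: "continuous_on {0..1::real} \<phi>" "\<And>t. t \<in> {0..1} \<Longrightarrow> \<phi> t \<in> wedge \<kappa>"
    and int: "(\<phi> has_integral I) {0..1}" and "0 \<le> cos \<kappa>"
  shows "cos \<kappa> * integral {0..1} (\<lambda>t. cmod (\<phi> t)) \<le> Re I" and "I \<in> wedge \<kappa>"
proof -
  have ni: "(\<lambda>t. cmod (\<phi> t)) integrable_on {0..1}"
    by (intro integrable_continuous_interval continuous_intros \<phi>)
  have re: "((\<lambda>t. Re (\<phi> t)) has_integral Re I) {0..1}"
    using has_integral_linear[OF int bounded_linear_Re] by (simp add: o_def)
  have "((\<lambda>t. cos \<kappa> * cmod (\<phi> t)) has_integral cos \<kappa> * integral {0..1} (\<lambda>t. cmod (\<phi> t))) {0..1}"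
    by (intro has_integral_mult_right integrable_integral ni)
  from has_integral_le[OF this re] show 1: "cos \<kappa> * integral {0..1} (\<lambda>t. cmod (\<phi> t)) \<le> Re I"
    using \<phi>(2) by (simp add: wedge_def)
  have "cmod I \<le> integral {0..1} (\<lambda>t. cmod (\<phi> t))"
    using integral_norm_bound_integral[OF has_integral_integrable[OF int] ni] integral_unique[OF int]
    by simp
  from mult_left_mono[OF this \<open>0 \<le> cos \<kappa>\<close>] 1 show "I \<in> wedge \<kappa>" by (simp add: wedge_def)
qed

text \<open>
  The sum over l \<le> k of the partial sums of q at the point \<rho>, that is, k + 1 times the k-th
  Fejer mean.  For \<rho> = 1 it is the k-th coefficient of q / (1 - X)^2.
\<close>

definition fejer_sum :: "complex fps \<Rightarrow> nat \<Rightarrow> real \<Rightarrow> complex" where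
  "fejer_sum q k \<rho> = (\<Sum>l\<le>k. \<Sum>m\<le>l. of_real \<rho> ^ m * fps_nth q m)"

text \<open>
  This is k + 1 times the usual Fejer kernel at the angle 2\<pi>t; the squared modulus shows its
  positivity.
\<close>

definition fejer_kernel :: "nat \<Rightarrow> real \<Rightarrow> real" where
  "fejer_kernel k t = (cmod (\<Sum>j\<le>k. cis (2 * pi * t * real j)))\<^sup>2"

lemma fejer_kernel_expand:
  "complex_of_real (fejer_kernel k t) = (\<Sum>l\<le>k. \<Sum>j\<le>k. cis (2 * pi * t * (real j - real l)))"
proof -
  have "complex_of_real (fejer_kernel k t)
      = (\<Sum>j\<le>k. cis (2 * pi * t * real j)) * (\<Sum>l\<le>k. cis (- (2 * pi * t * real l)))"
    unfolding fejer_kernel_def complex_norm_square by (simp add: cis_cnj)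
  also have "\<dots> = (\<Sum>l\<le>k. \<Sum>j\<le>k. cis (2 * pi * t * (real j - real l)))"
    by (simp add: sum_product cis_mult right_diff_distrib) (rule sum.swap)
  finally show ?thesis .
qed

text \<open>
  Expanding the kernel, the terms of positive frequency integrate to 0 against a holomorphic
  function and the others pick out its Taylor coefficients.  No conjugate of g enters, so the
  mean of g itself, and not only of its real part, is a Fejer sum of its Taylor series.
\<close>

lemma circle_mean_fejer:
  assumes g: "g holomorphic_on ball 0 1" and \<rho>: "0 < \<rho>" "\<rho> < 1"
  shows "((\<lambda>t. g (circle_point \<rho> t) * of_real (fejer_kernel k t)) has_integral
            fejer_sum (fps_expansion g 0) k \<rho>) {0..1}"
proof -
  define c where "c m = of_real \<rho> ^ m * fps_nth (fps_expansion g 0) m" for m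
  have summand: "((\<lambda>t. g (circle_point \<rho> t) * cis (2 * pi * t * (real j - real l))) has_integral
      (if j \<le> l then c (l - j) else 0)) {0..1}" for j l
  proof (cases "j \<le> l")
    case True
    have *: "- (2 * pi * t) * real (l - j) = 2 * pi * t * (real j - real l)" for t
      using True by (simp add: of_nat_diff algebra_simps)
    show ?thesis using circle_mean_coeff[OF g \<rho>, of "l - j", unfolded *] True by (simp add: c_def)
  next
    case False
    then have *: "2 * pi * t * real (j - l) = 2 * pi * t * (real j - real l)" for t
      by (simp add: of_nat_diff)
    show ?thesis using circle_mean_positive_frequency[OF g \<rho>, of "j - l", unfolded *] False by simp
  qed
  have "((\<lambda>t. \<Sum>l\<le>k. \<Sum>j\<le>k. g (circle_point \<rho> t) * cis (2 * pi * t * (real j - real l))) has_integral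
     (\<Sum>l\<le>k. \<Sum>j\<le>k. if j \<le> l then c (l - j) else 0)) {0..1}"
    by (intro has_integral_sum summand) auto
  moreover have "(\<Sum>l\<le>k. \<Sum>j\<le>k. if j \<le> l then c (l - j) else 0) = fejer_sum (fps_expansion g 0) k \<rho>"
    unfolding fejer_sum_def
  proof (rule sum.cong[OF refl])
    fix l assume "l \<in> {..k}"
    then have "(\<Sum>j\<le>k. if j \<le> l then c (l - j) else 0) = (\<Sum>j\<le>l. c (l - j))"
      by (intro sum.mono_neutral_cong_right) auto
    also have "\<dots> = (\<Sum>m\<le>l. c m)"
      by (rule sum.reindex_bij_witness[of _ "\<lambda>m. l - m" "\<lambda>m. l - m"]) auto
    finally show "(\<Sum>j\<le>k. if j \<le> l then c (l - j) else 0) = (\<Sum>m\<le>l. of_real \<rho> ^ m * fps_nth (fps_expansion g 0) m)"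
      by (simp add: c_def)
  qed
  ultimately show ?thesis
    by (simp add: fejer_kernel_expand sum_distrib_left)
qed


lemma continuous_on_circle_point:
  assumes "g holomorphic_on ball 0 1" "0 < \<rho>" "\<rho> < 1"
  shows "continuous_on {0..1} (\<lambda>t. g (circle_point \<rho> t))"
proof (rule continuous_on_compose2[OF holomorphic_on_imp_continuous_on[OF assms(1)]])
  show "continuous_on {0..1} (circle_point \<rho>)" by (intro continuous_intros)
qed (use assms in \<open>auto simp: norm_mult\<close>)

lemma cmod_circle_point: "0 < \<rho> \<Longrightarrow> cmod (circle_point \<rho> t) = \<rho>"
  by (simp add: norm_mult)

lemma continuous_on_fejer_kernel: "continuous_on A (fejer_kernel k)"
  unfolding fejer_kernel_def by (intro continuous_intros)

lemma fejer_kernel_nonneg: "0 \<le> fejer_kernel k t"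
  by (simp add: fejer_kernel_def)

lemma fejer_sum_tendsto: "((\<lambda>\<rho>. fejer_sum q k \<rho>) \<longlongrightarrow> fejer_sum q k 1) (at_left 1)"
  unfolding fejer_sum_def by (intro tendsto_intros)

lemma fejer_sum_mean_le:
  assumes Q: "Q holomorphic_on ball 0 1" "\<And>z. cmod z < 1 \<Longrightarrow> Q z \<in> wedge \<kappa>" "0 \<le> cos \<kappa>"
    and \<rho>: "0 < \<rho>" "\<rho> < 1"
  shows "cos \<kappa> * integral {0..1} (\<lambda>t. cmod (Q (circle_point \<rho> t)) * fejer_kernel k t)
           \<le> Re (fejer_sum (fps_expansion Q 0) k \<rho>)"
    and "fejer_sum (fps_expansion Q 0) k \<rho> \<in> wedge \<kappa>"
proof -
  have c: "continuous_on {0..1} (\<lambda>t. Q (circle_point \<rho> t) * of_real (fejer_kernel k t))"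
    by (intro continuous_intros continuous_on_circle_point Q \<rho> continuous_on_fejer_kernel)
  have w: "Q (circle_point \<rho> t) * of_real (fejer_kernel k t) \<in> wedge \<kappa>" for t
  proof -
    have "Q (circle_point \<rho> t) \<in> wedge \<kappa>" using \<rho> by (intro Q) (simp add: norm_mult)
    from wedge_scaleR[OF this fejer_kernel_nonneg[of k t]] show ?thesis by (simp add: mult.commute)
  qed
  note m = wedge_mean[OF c w circle_mean_fejer[OF Q(1) \<rho>] Q(3)]
  show "cos \<kappa> * integral {0..1} (\<lambda>t. cmod (Q (circle_point \<rho> t)) * fejer_kernel k t)
           \<le> Re (fejer_sum (fps_expansion Q 0) k \<rho>)"
    using m(1) by (simp add: norm_mult fejer_kernel_nonneg)
  show "fejer_sum (fps_expansion Q 0) k \<rho> \<in> wedge \<kappa>" by (rule m(2))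
qed

text \<open>
  The Fejer kernel is positive, so the Fejer sums of a wedge-valued function stay in the wedge,
  first for \<rho> < 1 and then in the limit.
\<close>

lemma fejer_sum_in_wedge:
  assumes Q: "Q holomorphic_on ball 0 1" "\<And>z. cmod z < 1 \<Longrightarrow> Q z \<in> wedge \<kappa>" "0 \<le> cos \<kappa>"
  shows "fejer_sum (fps_expansion Q 0) k 1 \<in> wedge \<kappa>"
proof -
  have "cos \<kappa> * cmod (fejer_sum (fps_expansion Q 0) k 1) \<le> Re (fejer_sum (fps_expansion Q 0) k 1)"
  proof (rule tendsto_le[of "at_left (1::real)"])
    show "eventually (\<lambda>\<rho>. cos \<kappa> * cmod (fejer_sum (fps_expansion Q 0) k \<rho>)
        \<le> Re (fejer_sum (fps_expansion Q 0) k \<rho>)) (at_left 1)"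
      using eventually_at_left_real[of 0 1]
      by (simp, elim eventually_mono) (use fejer_sum_mean_le(2)[OF Q] in \<open>auto simp: wedge_def\<close>)
  qed (auto intro!: tendsto_intros fejer_sum_tendsto)
  then show ?thesis by (simp add: wedge_def)
qed

lemma integral_fejer_kernel: "integral {0..1} (fejer_kernel k) = real (k + 1)"
proof -
  have "fps_expansion (\<lambda>_. 1) 0 = (1 :: complex fps)"
    by (rule fps_ext) (simp add: fps_expansion_def)
  then have "fejer_sum (fps_expansion (\<lambda>_. 1) 0) k (1 / 2) = of_nat (k + 1)"
    by (simp add: fejer_sum_def sum.delta mult_delta_right if_distrib[of "\<lambda>x. _ * x"] cong: if_cong)
  with circle_mean_fejer[of "\<lambda>_. 1" "1 / 2" k]
  have "((\<lambda>t. complex_of_real (fejer_kernel k t)) has_integral of_nat (k + 1)) {0..1}" by simp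
  from has_integral_linear[OF this bounded_linear_Re]
  have "(fejer_kernel k has_integral real (k + 1)) {0..1}" by (simp add: o_def)
  then show ?thesis by (rule integral_unique)
qed

text \<open>
  The quadratic polynomial l \<mapsto> \<integral> K (l u - 1)^2 / u is nonnegative, which bounds its discriminant.
\<close>

lemma integral_Cauchy_Schwarz_inverse:
  fixes u K :: "real \<Rightarrow> real"
  assumes u: "continuous_on {0..1} u" "\<And>t. t \<in> {0..1} \<Longrightarrow> 0 < u t"
    and K: "continuous_on {0..1} K" "\<And>t. t \<in> {0..1} \<Longrightarrow> 0 \<le> K t"
  shows "(integral {0..1} K)\<^sup>2 \<le> integral {0..1} (\<lambda>t. u t * K t) * integral {0..1} (\<lambda>t. inverse (u t) * K t)"
    (is "?I\<^sup>2 \<le> ?A * ?B")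
proof -
  have u0: "\<forall>t\<in>{0..1}. u t \<noteq> 0" using u(2) by force
  have i: "(\<lambda>t. u t * K t) integrable_on {0..1}" "(\<lambda>t. inverse (u t) * K t) integrable_on {0..1}"
      "K integrable_on {0..1}"
    by (intro integrable_continuous_interval continuous_intros u K u0)+
  have nn: "0 \<le> ?A" "0 \<le> ?B"
    by (intro integral_nonneg i mult_nonneg_nonneg K; use u in \<open>force simp: less_imp_le\<close>)+
  have quad: "2 * l * ?I \<le> l\<^sup>2 * ?A + ?B" for l :: real
  proof -
    have "((\<lambda>t. 2 * l * K t) has_integral 2 * l * ?I) {0..1}"
      by (intro has_integral_mult_right integrable_integral i)
    moreover have "((\<lambda>t. l\<^sup>2 * (u t * K t) + inverse (u t) * K t) has_integral l\<^sup>2 * ?A + ?B) {0..1}"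
      by (intro has_integral_add has_integral_mult_right integrable_integral i)
    ultimately show ?thesis
    proof (rule has_integral_le)
      fix t :: real assume t: "t \<in> {0..1}"
      have "0 \<le> (l * u t - 1)\<^sup>2 * inverse (u t)" using u(2)[OF t] by simp
      also have "\<dots> = l\<^sup>2 * u t + inverse (u t) - 2 * l"
        using u(2)[OF t] by (simp add: power2_eq_square field_simps)
      finally have "2 * l \<le> l\<^sup>2 * u t + inverse (u t)" by simp
      from mult_right_mono[OF this K(2)[OF t]]
      show "2 * l * K t \<le> l\<^sup>2 * (u t * K t) + inverse (u t) * K t"
        by (simp add: algebra_simps)
    qed
  qed
  show ?thesis
  proof (cases "?A = 0")
    case True
    have "?I = 0"
    proof (rule ccontr)
      assume "?I \<noteq> 0"
      then have "2 * ((?B + 1) / ?I) * ?I = 2 * (?B + 1)" by simp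
      with quad[of "(?B + 1) / ?I"] nn show False unfolding True by simp
    qed
    then show ?thesis using nn by simp
  next
    case False
    with nn have "0 < ?A" by linarith
    then show ?thesis using quad[of "?I / ?A"] by (simp add: power2_eq_square field_simps)
  qed
qed

text \<open>
  Up to the factor cos \<kappa>, the Fejer sums of Q and 1/Q are the integrals of |Q| and 1/|Q| against
  the same positive kernel of mass k + 1, and the Cauchy-Schwarz inequality bounds the product
  of these from below.  In this way an upper bound for 1/Q yields a lower bound for Q.
\<close>

lemma fejer_sum_reciprocal_bound:
  assumes Q: "Q holomorphic_on ball 0 1" "\<And>z. cmod z < 1 \<Longrightarrow> Q z \<in> wedge \<kappa>" "0 \<le> cos \<kappa>"
    and nz: "\<And>z. cmod z < 1 \<Longrightarrow> Q z \<noteq> 0"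
  shows "(cos \<kappa> * real (k + 1))\<^sup>2
    \<le> cmod (fejer_sum (fps_expansion Q 0) k 1) * cmod (fejer_sum (fps_expansion (\<lambda>z. inverse (Q z)) 0) k 1)"
proof (rule tendsto_lowerbound[of _ _ "at_left (1::real)"])
  define R where "R z = inverse (Q z)" for z
  have R: "R holomorphic_on ball 0 1" "\<And>z. cmod z < 1 \<Longrightarrow> R z \<in> wedge \<kappa>"
    unfolding R_def using nz Q by (auto intro!: holomorphic_intros inverse_in_wedge)
  show "((\<lambda>\<rho>. cmod (fejer_sum (fps_expansion Q 0) k \<rho>) * cmod (fejer_sum (fps_expansion (\<lambda>z. inverse (Q z)) 0) k \<rho>))
    \<longlongrightarrow> cmod (fejer_sum (fps_expansion Q 0) k 1) * cmod (fejer_sum (fps_expansion (\<lambda>z. inverse (Q z)) 0) k 1)) (at_left 1)"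
    by (intro tendsto_intros fejer_sum_tendsto)
  have "(cos \<kappa> * real (k + 1))\<^sup>2
     \<le> cmod (fejer_sum (fps_expansion Q 0) k \<rho>) * cmod (fejer_sum (fps_expansion R 0) k \<rho>)"
    if \<rho>: "0 < \<rho>" "\<rho> < 1" for \<rho>
  proof -
    define A where "A = integral {0..1} (\<lambda>t. cmod (Q (circle_point \<rho> t)) * fejer_kernel k t)"
    define B where "B = integral {0..1} (\<lambda>t. cmod (R (circle_point \<rho> t)) * fejer_kernel k t)"
    have "(real (k + 1))\<^sup>2 \<le> A * B"
      unfolding A_def B_def integral_fejer_kernel[symmetric] R_def norm_inverse
    proof (rule integral_Cauchy_Schwarz_inverse)
      show "continuous_on {0..1} (\<lambda>t. cmod (Q (circle_point \<rho> t)))"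
        by (intro continuous_intros continuous_on_circle_point Q \<rho>)
      show "0 < cmod (Q (circle_point \<rho> t))" for t
        using nz[of "circle_point \<rho> t"] \<rho> by (simp add: norm_mult)
    qed (use continuous_on_fejer_kernel fejer_kernel_nonneg in auto)
    then have "(cos \<kappa> * real (k + 1))\<^sup>2 \<le> (cos \<kappa> * A) * (cos \<kappa> * B)"
      using mult_left_mono[of "(real (k + 1))\<^sup>2" "A * B" "(cos \<kappa>)\<^sup>2"]
      by (simp add: power2_eq_square mult_ac)
    also have "\<dots> \<le> cmod (fejer_sum (fps_expansion Q 0) k \<rho>) * cmod (fejer_sum (fps_expansion R 0) k \<rho>)"
    proof (rule mult_mono)
      show "cos \<kappa> * A \<le> cmod (fejer_sum (fps_expansion Q 0) k \<rho>)"
        using fejer_sum_mean_le(1)[OF Q \<rho>, of k] complex_Re_le_cmod order_trans unfolding A_def by blast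
      show "cos \<kappa> * B \<le> cmod (fejer_sum (fps_expansion R 0) k \<rho>)"
        using fejer_sum_mean_le(1)[OF R Q(3) \<rho>, of k] complex_Re_le_cmod order_trans unfolding B_def by blast
      show "0 \<le> cos \<kappa> * B" unfolding B_def using Q(3) fejer_kernel_nonneg
        by (intro mult_nonneg_nonneg integral_nonneg integrable_continuous_interval continuous_intros
            continuous_on_circle_point R \<rho> continuous_on_fejer_kernel) auto
    qed auto
    finally show ?thesis .
  qed
  then show "eventually (\<lambda>\<rho>. (cos \<kappa> * real (k + 1))\<^sup>2
     \<le> cmod (fejer_sum (fps_expansion Q 0) k \<rho>) * cmod (fejer_sum (fps_expansion (\<lambda>z. inverse (Q z)) 0) k \<rho>)) (at_left 1)"
    using eventually_at_left_real[of 0 1] unfolding R_def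
    by (simp, elim eventually_mono) auto
qed simp

text \<open>
  Multiplication by 1 - X is undone by taking partial sums.
\<close>

lemma sum_fps_nth_one_minus_X_mult:
  "(\<Sum>m\<le>l. fps_nth ((1 - fps_X) * H) m) = fps_nth (H :: complex fps) l"
proof (induction l)
  case (Suc l)
  have "fps_nth ((1 - fps_X) * H) (Suc l) = fps_nth H (Suc l) - fps_nth H l"
    by (simp add: left_diff_distrib)
  with Suc show ?case by simp
qed (simp add: left_diff_distrib)

lemma fejer_sum_eq_coeff:
  assumes D: "D holomorphic_on ball 0 1"
  shows "fejer_sum (fps_expansion (\<lambda>z. (1 - z)\<^sup>2 * D z) 0) k 1 = fps_nth (fps_expansion D 0) k"
proof -
  define d where "d = fps_expansion D 0"
  have "D has_fps_expansion d"
    unfolding d_def by (rule has_fps_expansion_fps_expansion[OF open_ball _ D]) simp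
  then have "(\<lambda>z. (1 - z)\<^sup>2 * D z) has_fps_expansion (1 - fps_X)\<^sup>2 * d"
    by (intro fps_expansion_intros)
  then have "fps_expansion (\<lambda>z. (1 - z)\<^sup>2 * D z) 0 = (1 - fps_X) * ((1 - fps_X) * d)"
    by (intro fps_ext) (simp add: fps_expansion_def fps_nth_fps_expansion[symmetric] power2_eq_square mult.assoc)
  then show ?thesis
    by (simp add: fejer_sum_def sum_fps_nth_one_minus_X_mult d_def)
qed

text \<open>
  The k-th coefficient of Q(z) / (1 - z)^2 is at most \<rho>^(-k) times the mean of |Q| / |1 - z|^2 over
  |z| = \<rho>.  Up to the factor cos \<kappa> this is the mean of Re Q against a Poisson kernel, which
  equals Re Q(\<rho>^2) / (1 - \<rho>^2).  The radius with 1 - \<rho>^2 = 1 / (k + 2) balances the two factors.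
\<close>

lemma fejer_sum_upper_bound:
  assumes Q: "Q holomorphic_on ball 0 1" "\<And>z. cmod z < 1 \<Longrightarrow> Q z \<in> wedge \<kappa>" "0 < cos \<kappa>"
    and growth: "\<And>x::real. 0 < x \<Longrightarrow> x < 1 \<Longrightarrow> cmod (Q (of_real x)) \<le> C * (1 - x) powr p" and "p \<le> 1"
  obtains B where "0 < B" "\<And>k. cmod (fejer_sum (fps_expansion Q 0) k 1) \<le> B * real (k + 1) powr (1 - p)"
proof -
  define D where "D z = Q z / (1 - z)\<^sup>2" for z
  have D: "D holomorphic_on ball 0 1" unfolding D_def by (intro holomorphic_intros Q) auto
  have QD: "fejer_sum (fps_expansion Q 0) k 1 = fps_nth (fps_expansion D 0) k" for k
  proof -
    have "eventually (\<lambda>z::complex. z \<in> ball 0 1) (nhds 0)" by (intro eventually_nhds_in_open) auto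
    then have "eventually (\<lambda>z. Q z = (1 - z)\<^sup>2 * D z) (nhds 0)"
      by eventually_elim (auto simp: D_def)
    from fps_expansion_cong[OF this] show ?thesis using fejer_sum_eq_coeff[OF D] by simp
  qed
  have C: "0 \<le> C"
    using order_trans[OF norm_ge_zero growth[of "1 / 2"]] by (simp add: zero_le_mult_iff)
  have "cmod (fps_nth (fps_expansion D 0) k) \<le> exp 1 * C * 2 powr (1 - p) / cos \<kappa> * real (k + 1) powr (1 - p)" for k
  proof -
    define x where "x = real (k + 1) / real (k + 2)"
    define \<rho> where "\<rho> = sqrt x"
    have x: "0 < x" "x < 1" "1 - x = 1 / real (k + 2)" by (auto simp: x_def field_simps)
    then have \<rho>: "0 < \<rho>" "\<rho> < 1" "\<rho>\<^sup>2 = x" by (auto simp: \<rho>_def)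
    have nz: "1 - circle_point \<rho> t \<noteq> 0" for t
      using cmod_circle_point[OF \<rho>(1), of t] \<rho> by auto
    define I where "I = integral {0..1} (\<lambda>t. cmod (Q (circle_point \<rho> t) / of_real ((cmod (1 - circle_point \<rho> t))\<^sup>2)))"
    have coeff_le: "\<rho> ^ k * cmod (fps_nth (fps_expansion D 0) k) \<le> I"
    proof -
      have c: "continuous_on {0..1} (\<lambda>t. cmod (Q (circle_point \<rho> t) / of_real ((cmod (1 - circle_point \<rho> t))\<^sup>2)))"
        by (intro continuous_intros continuous_on_circle_point Q \<rho>) (use nz in auto)
      note m = circle_mean_coeff[OF D \<rho>(1,2), of k]
      have "cmod (integral {0..1} (\<lambda>t. D (circle_point \<rho> t) * cis (- (2 * pi * t) * real k))) \<le> I"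
        unfolding I_def
      proof (rule integral_norm_bound_integral)
        show "(\<lambda>t. D (circle_point \<rho> t) * cis (- (2 * pi * t) * real k)) integrable_on {0..1}"
          using m by (rule has_integral_integrable)
        show "(\<lambda>t. cmod (Q (circle_point \<rho> t) / of_real ((cmod (1 - circle_point \<rho> t))\<^sup>2))) integrable_on {0..1}"
          by (rule integrable_continuous_interval[OF c])
      qed (simp add: D_def norm_mult norm_divide norm_power)
      then show ?thesis
        using \<rho> unfolding integral_unique[OF m] by (simp add: norm_mult norm_power)
    qed
    have "cos \<kappa> * I \<le> Re (Q (of_real (\<rho>\<^sup>2)) / of_real (1 - \<rho>\<^sup>2))"
      unfolding I_def
    proof (rule wedge_mean(1)[OF _ _ circle_mean_Poisson[OF Q(1) \<rho>(1,2)]])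
      show "continuous_on {0..1} (\<lambda>t. Q (circle_point \<rho> t) / of_real ((cmod (1 - circle_point \<rho> t))\<^sup>2))"
        by (intro continuous_intros continuous_on_circle_point Q \<rho>) (use nz in auto)
      fix t :: real
      have "Q (circle_point \<rho> t) \<in> wedge \<kappa>" using \<rho> by (intro Q) (simp add: norm_mult)
      from wedge_scaleR[OF this, of "1 / (cmod (1 - circle_point \<rho> t))\<^sup>2"]
      show "Q (circle_point \<rho> t) / of_real ((cmod (1 - circle_point \<rho> t))\<^sup>2) \<in> wedge \<kappa>" by simp
    qed (use Q in auto)
    also have "\<dots> \<le> cmod (Q (of_real x)) / (1 - x)"
      using divide_right_mono[OF complex_Re_le_cmod[of "Q (of_real x)"], of "1 - x"] x(1,2)
      by (simp add: \<rho>(3) del: of_real_diff)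
    also have "\<dots> \<le> C * (1 - x) powr p / (1 - x)"
      using x growth[of x] by (intro divide_right_mono) auto
    also have "\<dots> = C * real (k + 2) powr (1 - p)"
      using x by (simp add: powr_diff powr_divide)
    also have "\<dots> \<le> C * (2 * real (k + 1)) powr (1 - p)"
      using C \<open>p \<le> 1\<close> by (intro mult_left_mono powr_mono2) auto
    also have "(2 * real (k + 1)) powr (1 - p) = 2 powr (1 - p) * real (k + 1) powr (1 - p)"
      by (rule powr_mult)
    finally have "I \<le> C * (2 powr (1 - p) * real (k + 1) powr (1 - p)) / cos \<kappa>"
      using Q(3) by (simp add: pos_le_divide_eq mult.commute)
    with coeff_le have main: "\<rho> ^ k * cmod (fps_nth (fps_expansion D 0) k)
        \<le> C * (2 powr (1 - p) * real (k + 1) powr (1 - p)) / cos \<kappa>"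
      by linarith
    \<comment> \<open>The loss rho^(-k) is bounded: it is at most x^(-k) = (1 + 1/(k+1))^k.\<close>
    have "1 \<le> exp 1 * \<rho> ^ k"
    proof -
      have "(1 / x) ^ k \<le> exp (1 / real (k + 1)) ^ k"
        using exp_ge_add_one_self[of "1 / real (k + 1)"] by (intro power_mono) (auto simp: x_def field_simps)
      also have "\<dots> = exp (real k / real (k + 1))" by (simp add: exp_of_nat_mult[symmetric])
      also have "\<dots> \<le> exp 1" by simp
      finally have "1 \<le> exp 1 * x ^ k" using x by (simp add: power_divide field_simps)
      also have "x ^ k \<le> \<rho> ^ k"
        using \<rho> by (intro power_mono) (auto simp: \<rho>(3)[symmetric] power2_eq_square)
      finally show ?thesis by simp
    qed
    then have "1 * cmod (fps_nth (fps_expansion D 0) k) \<le> (exp 1 * \<rho> ^ k) * cmod (fps_nth (fps_expansion D 0) k)"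
      by (intro mult_right_mono) auto
    also have "\<dots> \<le> exp 1 * (C * (2 powr (1 - p) * real (k + 1) powr (1 - p)) / cos \<kappa>)"
      using mult_left_mono[OF main, of "exp 1"] by (simp only: mult.assoc) simp
    finally show ?thesis by (simp add: mult_ac)
  qed
  note bd = this
  show ?thesis
  proof
    \<comment> \<open>C may vanish, and adding 1 makes the constant positive.\<close>
    show "0 < exp 1 * C * 2 powr (1 - p) / cos \<kappa> + 1"
      using C Q(3) by (intro add_nonneg_pos) auto
    fix k
    show "cmod (fejer_sum (fps_expansion Q 0) k 1) \<le> (exp 1 * C * 2 powr (1 - p) / cos \<kappa> + 1) * real (k + 1) powr (1 - p)"
      unfolding QD using bd[of k] by (simp add: distrib_right add_increasing2)
  qed
qed

lemma fps_expansion_deriv_nth: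
  "fps_nth (fps_expansion (deriv F) 0) k = of_nat (k + 1) * fps_nth (fps_expansion F 0) (k + 1)"
  using of_nat_neq_0[of k, where ?'a = complex]
  by (simp add: fps_expansion_def funpow_Suc_right del: funpow.simps)

text \<open>
  With Q(z) = (1 - z)^2 F'(z), k times the k-th coefficient of F is the Fejer sum of Q of index k - 1.
  It therefore stays in the wedge, is bounded above through the growth of Q, and is bounded
  below through the reciprocal bound, because 1/Q is again wedge-valued and its growth is
  limited by the opening of the wedge.
\<close>

lemma wedge_derivative_coefficients:
  fixes F :: "complex \<Rightarrow> complex"
  assumes F: "F holomorphic_on ball 0 1" "\<And>z. cmod z < 1 \<Longrightarrow> deriv F z \<noteq> 0"
    and Q: "\<And>z. cmod z < 1 \<Longrightarrow> (1 - z)\<^sup>2 * deriv F z \<in> wedge \<kappa>"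
    and \<kappa>: "0 < \<kappa>" "\<kappa> < pi / 2" "2 * \<kappa> / pi < \<sigma>"
    and growth: "\<And>x::real. 0 < x \<Longrightarrow> x < 1 \<Longrightarrow> cmod ((1 - of_real x)\<^sup>2 * deriv F (of_real x)) \<le> C * (1 - x) powr p" and "p \<le> 1"
  obtains A B where "0 < A" "0 < B" "\<And>k. 0 < k \<Longrightarrow> fps_nth (fps_expansion F 0) k \<in> wedge \<kappa>"
    "\<And>k. 0 < k \<Longrightarrow> cmod (fps_nth (fps_expansion F 0) k) \<le> B * real k powr (- p)"
    "\<And>k. 0 < k \<Longrightarrow> A * real k powr (- \<sigma>) \<le> cmod (fps_nth (fps_expansion F 0) k)"
proof -
  define Q where "Q z = (1 - z)\<^sup>2 * deriv F z" for z
  define R where "R z = inverse (Q z)" for z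
  define a where "a = fps_nth (fps_expansion F 0)"
  have cos: "0 < cos \<kappa>" using \<kappa> by (intro cos_gt_zero) auto
  have dF: "deriv F holomorphic_on ball 0 1" by (intro holomorphic_deriv F) auto
  have Qh: "Q holomorphic_on ball 0 1" unfolding Q_def by (intro holomorphic_intros dF)
  have Qw: "Q z \<in> wedge \<kappa>" if "cmod z < 1" for z using Q[OF that] by (simp add: Q_def)
  have Qnz: "Q z \<noteq> 0" if "cmod z < 1" for z using F(2)[OF that] that by (auto simp: Q_def)
  have Rh: "R holomorphic_on ball 0 1" unfolding R_def by (intro holomorphic_intros Qh) (use Qnz in auto)
  have Rw: "R z \<in> wedge \<kappa>" "R z \<noteq> 0" if "cmod z < 1" for z
    using inverse_in_wedge[OF Qw[OF that]] Qnz[OF that] by (auto simp: R_def)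
  have coeff: "fejer_sum (fps_expansion Q 0) k 1 = of_nat (k + 1) * a (k + 1)" for k
    unfolding Q_def fejer_sum_eq_coeff[OF dF] fps_expansion_deriv_nth a_def ..
  have cm: "cmod (fejer_sum (fps_expansion Q 0) k 1) = real (k + 1) * cmod (a (k + 1))" for k
    unfolding coeff by (simp add: norm_mult del: of_nat_Suc of_nat_add)
  obtain B where B: "0 < B" "\<And>k. cmod (fejer_sum (fps_expansion Q 0) k 1) \<le> B * real (k + 1) powr (1 - p)"
    using fejer_sum_upper_bound[OF Qh Qw cos, of C p] growth \<open>p \<le> 1\<close> unfolding Q_def by blast
  obtain C' where C': "0 < C'" "\<And>z. cmod z < 1 \<Longrightarrow> cmod (R z) \<le> C' * (1 - cmod z) powr (- \<sigma>)"
    using wedge_valued_growth[OF Rh Rw(2,1) \<kappa>] by blast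
  have "0 < \<sigma>" using \<kappa> by (meson divide_pos_pos mult_pos_pos order_less_trans pi_gt_zero zero_less_numeral)
  have "cmod (R (of_real x)) \<le> C' * (1 - x) powr (- \<sigma>)" if "0 < x" "x < 1" for x :: real
    using C'(2)[of "of_real x"] that by simp
  from fejer_sum_upper_bound[OF Rh Rw(1) cos this] \<open>0 < \<sigma>\<close>
  obtain B' where B': "0 < B'" "\<And>k. cmod (fejer_sum (fps_expansion R 0) k 1) \<le> B' * real (k + 1) powr (1 + \<sigma>)"
    by (auto simp: algebra_simps)
  show ?thesis
  proof
    show "0 < (cos \<kappa>)\<^sup>2 / B'" "0 < B" using B B' cos by auto
    fix k :: nat assume "0 < k"
    then obtain j where k: "k = j + 1" by (metis Suc_eq_plus1 gr0_conv_Suc)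
    have kp: "0 < real k" using \<open>0 < k\<close> by simp
    have "of_real (1 / real k) * fejer_sum (fps_expansion Q 0) j 1 \<in> wedge \<kappa>"
      using cos by (intro wedge_scaleR fejer_sum_in_wedge Qh Qw) auto
    then show "fps_nth (fps_expansion F 0) k \<in> wedge \<kappa>"
      using kp unfolding coeff k[symmetric] by (simp add: a_def)
    have "real k * cmod (a k) \<le> B * real k powr (1 - p)"
      using B(2)[of j] unfolding cm k[symmetric] .
    also have "\<dots> = real k * (B * real k powr (- p))"
      using kp by (simp add: powr_diff powr_minus_divide)
    finally show "cmod (fps_nth (fps_expansion F 0) k) \<le> B * real k powr (- p)"
      using kp by (simp add: a_def)
    have "(cos \<kappa>)\<^sup>2 * (real k)\<^sup>2 \<le> (real k * cmod (a k)) * cmod (fejer_sum (fps_expansion R 0) j 1)"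
      using fejer_sum_reciprocal_bound[OF Qh Qw _ Qnz, of j] cos unfolding cm k[symmetric] R_def[symmetric]
      by (simp add: power_mult_distrib)
    also have "\<dots> \<le> (real k * cmod (a k)) * (B' * real k powr (1 + \<sigma>))"
      using B'(2)[of j] unfolding k[symmetric] by (intro mult_left_mono) auto
    also have "\<dots> = (real k)\<^sup>2 * (cmod (a k) * B' * real k powr \<sigma>)"
      using kp by (simp add: powr_add power2_eq_square)
    finally have "(cos \<kappa>)\<^sup>2 \<le> cmod (a k) * B' * real k powr \<sigma>"
      using kp by (simp add: mult.commute[of "(cos \<kappa>)\<^sup>2"])
    then show "(cos \<kappa>)\<^sup>2 / B' * real k powr (- \<sigma>) \<le> cmod (fps_nth (fps_expansion F 0) k)"
      using B'(1) kp by (simp add: a_def powr_minus_divide field_simps)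
  qed
qed

section \<open>Coefficients of convex mappings and their Hadamard products\<close>

text \<open>
  Cauchy's estimate on the disc around x of radius half the distance to the unit circle.
\<close>

lemma derivative_growth_near_boundary:
  assumes H: "H holomorphic_on ball 0 1" and "0 \<le> \<tau>" "0 < C"
    and growth: "\<And>z. cmod z < 1 \<Longrightarrow> cmod (H z) \<le> C * (1 - cmod z) powr (- \<tau>)"
    and x: "0 < x" "x < (1::real)"
  shows "cmod ((1 - of_real x)\<^sup>2 * deriv H (of_real x)) \<le> C * 2 powr (\<tau> + 1) * (1 - x) powr (1 - \<tau>)"
proof -
  define r where "r = (1 - x) / 2"
  have r: "0 < r" "1 - x = 2 * r" using x by (auto simp: r_def)
  have sub: "cball (complex_of_real x) r \<subseteq> ball 0 1"
  proof
    fix w assume "w \<in> cball (complex_of_real x) r"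
    then have "cmod (w - of_real x) \<le> r" by (simp add: dist_norm norm_minus_commute)
    moreover have "cmod w \<le> cmod (of_real x) + cmod (w - of_real x)" by (rule norm_triangle_sub)
    moreover have "cmod (of_real x) = x" using x(1) by simp
    ultimately have "cmod w < 1" using x r by linarith
    then show "w \<in> ball 0 1" by (simp only: mem_ball_0)
  qed
  have "cmod ((deriv ^^ 1) H (of_real x)) \<le> fact 1 * (C * r powr (- \<tau>)) / r ^ 1"
  proof (rule Cauchy_inequality)
    show "H holomorphic_on ball (of_real x) r"
      using sub ball_subset_cball by (intro holomorphic_on_subset[OF H]) blast
    show "continuous_on (cball (of_real x) r) H"
      using sub by (intro holomorphic_on_imp_continuous_on holomorphic_on_subset[OF H])
    fix w :: complex assume w: "cmod (of_real x - w) = r"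
    moreover have "cmod w \<le> cmod (of_real x) + cmod (w - of_real x)" by (rule norm_triangle_sub)
    moreover have "cmod (of_real x) = x" using x(1) by simp
    ultimately have w1: "r \<le> 1 - cmod w" using r(2) norm_minus_commute[of w "of_real x"] by linarith
    then have "cmod (H w) \<le> C * (1 - cmod w) powr (- \<tau>)" using r by (intro growth) linarith
    also have "\<dots> \<le> C * r powr (- \<tau>)"
      using w1 r \<open>0 \<le> \<tau>\<close> \<open>0 < C\<close> by (intro mult_left_mono powr_mono2') auto
    finally show "cmod (H w) \<le> C * r powr (- \<tau>)" .
  qed (rule r)
  then have d: "cmod (deriv H (of_real x)) \<le> C * r powr (- \<tau>) / r" by simp
  have "cmod ((1 - of_real x)\<^sup>2 * deriv H (of_real x)) = (1 - x)\<^sup>2 * cmod (deriv H (of_real x))"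
    using x norm_of_real[of "1 - x", where ?'a = complex] by (simp add: norm_mult norm_power)
  also have "\<dots> \<le> (1 - x)\<^sup>2 * (C * r powr (- \<tau>) / r)"
    by (intro mult_left_mono d) auto
  also have "\<dots> = C * 2 powr (\<tau> + 1) * (1 - x) powr (1 - \<tau>)"
    unfolding r(2) using r(1)
    by (simp add: powr_mult powr_diff powr_add powr_minus_divide power2_eq_square field_simps)
  finally show ?thesis .
qed

text \<open>
  The normal form and the preceding bounds combined.  Translation invariance under a wedge of
  half-angle nearly \<pi>\<alpha>/2 puts (1 - z)^2 H' into the complementary wedge, of half-angle nearly
  \<pi>(1 - \<alpha>)/2, where H is the normalised mapping rotated so that the boundary point fixed by the translations is 1.
  Containment of the image in a wedge of half-angle nearly \<pi>\<alpha>/2 limits the growth of H and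
  thereby of H'.
\<close>

lemma convex_mapping_coefficients:
  assumes f: "convex_mapping f" and angle: "mapping_angle_at_infinity f = pi * \<alpha>"
    and \<epsilon>: "0 < \<epsilon>" "\<epsilon> < \<alpha>" "\<alpha> + \<epsilon> < 1"
  obtains c \<zeta> A B where "cmod c = 1" "cmod \<zeta> = 1" "0 < A" "0 < B"
    "\<And>k. 0 < k \<Longrightarrow> c * \<zeta> ^ k * fps_nth (fps_expansion f 0) k \<in> wedge (pi * (1 - \<alpha> + \<epsilon>) / 2)"
    "\<And>k. 0 < k \<Longrightarrow> cmod (fps_nth (fps_expansion f 0) k) \<le> B * real k powr (- (1 - \<alpha> - \<epsilon>))"
    "\<And>k. 0 < k \<Longrightarrow> A * real k powr (- (1 - \<alpha> + \<epsilon>)) \<le> cmod (fps_nth (fps_expansion f 0) k)"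
proof -
  \<comment> \<open>Half of the margin goes into the wedges, the other half into the growth exponents.\<close>
  define \<delta> where "\<delta> = \<epsilon> / 2"
  have \<delta>: "0 < \<delta>" "\<delta> < \<alpha>" "\<alpha> + \<delta> < 1" "\<delta> < \<epsilon>" using \<epsilon> by (auto simp: \<delta>_def)
  obtain c v where c: "cmod c = 1"
    and wedge_im: "\<And>z. z \<in> ball 0 1 \<Longrightarrow> c * (f z - v) \<in> wedge (pi * (\<alpha> + \<delta>) / 2)"
    and recession: "\<And>z w. z \<in> ball 0 1 \<Longrightarrow> w \<in> wedge (pi * (\<alpha> - \<delta>) / 2) \<Longrightarrow>
       c * (f z - v) + w \<in> (\<lambda>z. c * (f z - v)) ` ball 0 1"
    using convex_mapping_normal_form[OF f angle \<delta>(1-3)] by metis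
  have fh: "f holomorphic_on ball 0 1" and fi: "inj_on f (ball 0 1)"
    using f by (auto simp: convex_mapping_def)
  have "c \<noteq> 0" using c by auto
  define F where "F z = c * (f z - v)" for z
  have Fh: "F holomorphic_on ball 0 1" unfolding F_def by (intro holomorphic_intros fh)
  have Fi: "inj_on F (ball 0 1)" using fi \<open>c \<noteq> 0\<close> by (auto simp: inj_on_def F_def)
  define \<mu> where "\<mu> = pi * (\<alpha> - \<delta>) / 2"
  define \<kappa> where "\<kappa> = pi / 2 - \<mu>"
  have \<mu>: "0 < \<mu>" "\<mu> < pi / 2" using \<delta> by (auto simp: \<mu>_def)
  have \<kappa>_eq: "\<kappa> = pi * (1 - \<alpha> + \<delta>) / 2" by (simp add: \<kappa>_def \<mu>_def field_simps)
  have \<kappa>: "0 < \<kappa>" "\<kappa> < pi / 2" "2 * \<kappa> / pi < 1 - \<alpha> + \<epsilon>"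
    using \<mu> \<delta> unfolding \<kappa>_def[symmetric] by (simp_all add: \<kappa>_def) (simp add: \<mu>_def field_simps)
  have rec: "x + w \<in> F ` ball 0 1" if "x \<in> F ` ball 0 1" "w \<in> wedge \<mu>" for x w
    using that recession by (auto simp: F_def \<mu>_def)
  obtain \<zeta> where \<zeta>: "cmod \<zeta> = 1"
    and der: "\<And>z. z \<in> ball 0 1 \<Longrightarrow> \<zeta> * (1 - cnj \<zeta> * z)\<^sup>2 * deriv F z \<in> wedge \<kappa>"
    using recession_imp_derivative_in_wedge[OF Fh Fi \<mu> rec] unfolding \<kappa>_def by metis
  have "\<zeta> \<noteq> 0" using \<zeta> by auto
  have \<zeta>\<zeta>: "cnj \<zeta> * \<zeta> = 1" using complex_norm_square[of \<zeta>] \<zeta> by (simp add: mult.commute)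
  \<comment> \<open>Adding 1 keeps the values in the wedge and away from 0, so that powers of H are defined;
    it only affects the coefficient of index 0.\<close>
  define H where "H z = F (\<zeta> * z) + 1" for z
  have rot: "\<zeta> * z \<in> ball 0 1" if "cmod z < 1" for z using that \<zeta> by (simp add: norm_mult)
  have Hh: "H holomorphic_on ball 0 1"
    unfolding H_def
    by (intro holomorphic_intros holomorphic_on_compose_gen[of "\<lambda>z. \<zeta> * z" _ F "ball 0 1", unfolded o_def] Fh)
       (use rot in auto)
  have H': "deriv H z = \<zeta> * deriv F (\<zeta> * z)" if "cmod z < 1" for z
  proof -
    have "(F has_field_derivative deriv F (\<zeta> * z)) (at (\<zeta> * z))"
      using holomorphic_derivI[OF Fh open_ball rot[OF that]] .
    moreover have "((\<lambda>z. \<zeta> * z) has_field_derivative \<zeta>) (at z)"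
      by (auto intro!: derivative_eq_intros)
    ultimately have "((\<lambda>z. F (\<zeta> * z)) has_field_derivative deriv F (\<zeta> * z) * \<zeta>) (at z)"
      by (rule DERIV_chain2)
    then have "(H has_field_derivative deriv F (\<zeta> * z) * \<zeta>) (at z)"
      unfolding H_def by (auto intro!: derivative_eq_intros)
    then show ?thesis by (simp add: DERIV_imp_deriv mult.commute)
  qed
  have H'nz: "deriv H z \<noteq> 0" if "cmod z < 1" for z
    using holomorphic_injective_imp_regular[OF Fh open_ball Fi rot[OF that]] \<open>\<zeta> \<noteq> 0\<close> by (simp add: H'[OF that])
  have HQ: "(1 - z)\<^sup>2 * deriv H z \<in> wedge \<kappa>" if "cmod z < 1" for z
  proof -
    have "\<zeta> * (1 - cnj \<zeta> * (\<zeta> * z))\<^sup>2 * deriv F (\<zeta> * z) = (1 - z)\<^sup>2 * deriv H z"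
      unfolding H'[OF that] mult.assoc[of "cnj \<zeta>" \<zeta> z, symmetric] \<zeta>\<zeta> by (simp add: mult_ac)
    with der[OF rot[OF that]] show ?thesis by simp
  qed
  define \<kappa>1 where "\<kappa>1 = pi * (\<alpha> + \<delta>) / 2"
  have \<kappa>1: "0 < \<kappa>1" "\<kappa>1 < pi / 2" "2 * \<kappa>1 / pi < \<alpha> + \<epsilon>" using \<delta> by (auto simp: \<kappa>1_def)
  have "0 < cos \<kappa>1" using \<kappa>1 by (intro cos_gt_zero) auto
  have Hw: "H z \<in> wedge \<kappa>1" "H z \<noteq> 0" if "cmod z < 1" for z
  proof -
    have Fw: "F (\<zeta> * z) \<in> wedge \<kappa>1" using wedge_im[OF rot[OF that]] by (simp add: F_def \<kappa>1_def)
    then show "H z \<in> wedge \<kappa>1"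
      unfolding H_def using \<open>0 < cos \<kappa>1\<close> by (intro wedge_add) (auto simp: wedge_def)
    have "0 \<le> cos \<kappa>1 * cmod (F (\<zeta> * z))" using \<open>0 < cos \<kappa>1\<close> by simp
    then have "0 \<le> Re (F (\<zeta> * z))" using Fw by (simp add: wedge_def)
    then have "0 < Re (H z)" by (simp add: H_def)
    then show "H z \<noteq> 0" by auto
  qed
  obtain C where C: "0 < C" "\<And>z. cmod z < 1 \<Longrightarrow> cmod (H z) \<le> C * (1 - cmod z) powr (- (\<alpha> + \<epsilon>))"
    using wedge_valued_growth[OF Hh Hw(2,1) \<kappa>1] by blast
  have growth: "cmod ((1 - of_real x)\<^sup>2 * deriv H (of_real x))
      \<le> C * 2 powr (\<alpha> + \<epsilon> + 1) * (1 - x) powr (1 - \<alpha> - \<epsilon>)" if "0 < x" "x < 1" for x :: real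
    using derivative_growth_near_boundary[OF Hh _ C that] \<epsilon> by (simp add: algebra_simps)
  obtain A B where AB: "0 < A" "0 < B" "\<And>k. 0 < k \<Longrightarrow> fps_nth (fps_expansion H 0) k \<in> wedge \<kappa>"
    "\<And>k. 0 < k \<Longrightarrow> cmod (fps_nth (fps_expansion H 0) k) \<le> B * real k powr (- (1 - \<alpha> - \<epsilon>))"
    "\<And>k. 0 < k \<Longrightarrow> A * real k powr (- (1 - \<alpha> + \<epsilon>)) \<le> cmod (fps_nth (fps_expansion H 0) k)"
    using wedge_derivative_coefficients[OF Hh H'nz HQ \<kappa> growth] \<epsilon> by auto
  have coeff: "fps_nth (fps_expansion H 0) k = c * \<zeta> ^ k * fps_nth (fps_expansion f 0) k" if "0 < k" for k
  proof -
    have fz: "(\<lambda>z. f (\<zeta> * z)) holomorphic_on ball 0 1"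
      by (rule holomorphic_on_compose_gen[of "\<lambda>z. \<zeta> * z" _ f "ball 0 1", unfolded o_def])
         (use rot fh in \<open>auto intro!: holomorphic_intros\<close>)
    then have cfz: "(\<lambda>z. c * f (\<zeta> * z)) holomorphic_on ball 0 1"
      by (intro holomorphic_intros)
    have 0: "0 \<in> ball (0::complex) 1" by simp
    have "H = (\<lambda>z. c * f (\<zeta> * z) + (1 - c * v))" by (simp add: H_def F_def fun_eq_iff algebra_simps)
    then have "(deriv ^^ k) H 0 = (deriv ^^ k) (\<lambda>z. c * f (\<zeta> * z)) 0 + (deriv ^^ k) (\<lambda>z. 1 - c * v) 0"
      using higher_deriv_add[OF cfz holomorphic_on_const open_ball 0, of k "1 - c * v"] by simp
    also have "(deriv ^^ k) (\<lambda>z. 1 - c * v) 0 = 0" using that by simp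
    also have "(deriv ^^ k) (\<lambda>z. c * f (\<zeta> * z)) 0 = c * (deriv ^^ k) (\<lambda>z. f (\<zeta> * z)) 0"
      by (rule higher_deriv_cmult[OF fz 0 open_ball])
    also have "(deriv ^^ k) (\<lambda>z. f (\<zeta> * z)) 0 = \<zeta> ^ k * (deriv ^^ k) f (\<zeta> * 0)"
      by (rule higher_deriv_compose_linear[OF fh open_ball open_ball 0]) (use rot in auto)
    finally show ?thesis by (simp add: fps_expansion_def)
  qed
  have norm_coeff: "cmod (fps_nth (fps_expansion H 0) k) = cmod (fps_nth (fps_expansion f 0) k)" if "0 < k" for k
    using c \<zeta> by (simp add: coeff[OF that] norm_mult norm_power)
  have "wedge \<kappa> \<subseteq> wedge (pi * (1 - \<alpha> + \<epsilon>) / 2)"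
    using \<kappa>(1) \<delta> \<epsilon> unfolding \<kappa>_eq by (intro wedge_mono) auto
  with AB that[OF c \<zeta> AB(1,2)] show ?thesis
    by (auto simp: coeff[symmetric] norm_coeff[symmetric])
qed

lemma wedge_prod:
  assumes "finite I" "\<And>i. i \<in> I \<Longrightarrow> u i \<in> wedge (\<kappa> i)" "\<And>i. i \<in> I \<Longrightarrow> 0 \<le> \<kappa> i" "sum \<kappa> I \<le> pi"
  shows "prod u I \<in> wedge (sum \<kappa> I)"
  using assms
proof (induction I rule: finite_induct)
  case empty
  then show ?case by (simp add: wedge_def)
next
  case (insert i I)
  have nn: "0 \<le> sum \<kappa> I" "0 \<le> \<kappa> i" using insert.prems by (auto intro: sum_nonneg)
  have le: "\<kappa> i + sum \<kappa> I \<le> pi" using insert by simp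
  then have "prod u I \<in> wedge (sum \<kappa> I)" using insert nn by auto
  then obtain t where t: "\<bar>t\<bar> \<le> sum \<kappa> I" "prod u I = of_real (cmod (prod u I)) * cis t"
    using wedgeE_cis nn le by (metis add_increasing order_refl order_trans)
  obtain s where s: "\<bar>s\<bar> \<le> \<kappa> i" "u i = of_real (cmod (u i)) * cis s"
    using wedgeE_cis[of "u i" "\<kappa> i"] insert nn le by auto
  have "u i * prod u I = of_real (cmod (u i) * cmod (prod u I)) * cis (s + t)"
    by (subst s(2), subst t(2)) (simp add: cis_mult[symmetric])
  also have "\<dots> \<in> wedge (\<kappa> i + sum \<kappa> I)"
    using s t le by (intro wedgeI_cis) auto
  finally show ?case using insert by simp
qed

text \<open>
  Writing r = s^2 distributes the powers of r evenly over both factors; one factor stays bounded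
  while the other is absolutely summable.
\<close>

lemma conv_radius_mult_pointwise_ge_1:
  fixes a b :: "nat \<Rightarrow> complex"
  assumes "1 \<le> conv_radius a" "1 \<le> conv_radius b"
  shows "1 \<le> conv_radius (\<lambda>k. a k * b k)"
proof (rule conv_radius_geI_ex)
  fix r :: real assume r: "0 < r" "ereal r < 1"
  define s where "s = sqrt r"
  have s: "0 < s" "s < 1" "s * s = r" using r by (auto simp: s_def)
  have "ereal s < conv_radius a" "ereal s < conv_radius b"
    using s less_le_trans[OF _ assms(1), of "ereal s"] less_le_trans[OF _ assms(2), of "ereal s"] by auto
  then have sa: "summable (\<lambda>k. a k * of_real s ^ k)" and sb: "summable (\<lambda>k. norm (b k * of_real s ^ k))"
    using s by (auto intro!: summable_in_conv_radius abs_summable_in_conv_radius)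
  from tendsto_norm_zero[OF summable_LIMSEQ_zero[OF sa]]
  have "eventually (\<lambda>k. norm (a k * of_real s ^ k) < 1) sequentially"
    by (rule order_tendstoD) simp
  then have "eventually (\<lambda>k. norm (a k * b k * of_real r ^ k) \<le> norm (b k * of_real s ^ k)) sequentially"
  proof eventually_elim
    case (elim k)
    have "norm (a k * b k * of_real r ^ k) = norm (a k * of_real s ^ k) * norm (b k * of_real s ^ k)"
      using s by (simp add: norm_mult norm_power s(3)[symmetric] power_mult_distrib)
    also have "\<dots> \<le> 1 * norm (b k * of_real s ^ k)"
      using elim by (intro mult_right_mono) auto
    finally show ?case by simp
  qed
  from summable_comparison_test_ev[OF this sb] have "summable (\<lambda>k. a k * b k * of_real r ^ k)" .
  then show "\<exists>z. norm z = r \<and> summable (\<lambda>k. a k * b k * z ^ k)"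
    using r by (intro exI[of _ "of_real r"]) auto
qed

text \<open>
  The n-fold Hadamard product as a single power series, in which the factors appear
  symmetrically.
\<close>

definition hadamard_fps :: "nat \<Rightarrow> (nat \<Rightarrow> complex \<Rightarrow> complex) \<Rightarrow> complex fps" where
  "hadamard_fps n g = Abs_fps (\<lambda>k. \<Prod>i\<in>{1..n}. fps_nth (fps_expansion (g i) 0) k)"

lemma fps_conv_radius_hadamard_fps:
  assumes "1 \<le> n" "\<And>i. i \<in> {1..n} \<Longrightarrow> g i holomorphic_on ball 0 1"
  shows "1 \<le> fps_conv_radius (hadamard_fps n g)"
  using assms
proof (induction n rule: dec_induct)
  case base
  have "1 \<le> fps_conv_radius (fps_expansion (g 1) 0)"
    using base by (intro conv_radius_fps_expansion) (simp add: one_ereal_def)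
  then show ?case by (simp add: hadamard_fps_def fps_conv_radius_def)
next
  case (step n)
  have "1 \<le> fps_conv_radius (fps_expansion (g (Suc n)) 0)"
    using step by (intro conv_radius_fps_expansion) (simp add: one_ereal_def)
  with conv_radius_mult_pointwise_ge_1[of "fps_nth (hadamard_fps n g)" "fps_nth (fps_expansion (g (Suc n)) 0)"] step
  show ?case by (simp add: hadamard_fps_def fps_conv_radius_def atLeastAtMostSuc_conv mult.commute)
qed

text \<open>
  Each step of the iterated product expands the previous one again at 0; as its power series
  converges in the disc, the expansion returns that series.
\<close>

lemma hadamard_upto_eq_eval_fps:
  assumes "1 \<le> n" "\<And>i. i \<in> {1..n} \<Longrightarrow> g i holomorphic_on ball 0 1" "z \<in> ball 0 1"
  shows "hadamard_upto n g z = eval_fps (hadamard_fps n g) z"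
  using assms
proof (induction n arbitrary: z rule: dec_induct)
  case base
  have "g 1 holomorphic_on eball 0 1" using base by (simp add: one_ereal_def)
  from eval_fps_expansion'[OF this, of z] base show ?case
    by (simp add: hadamard_upto_def hadamard_fps_def fps_nth_inverse)
next
  case (step n)
  have "eventually (\<lambda>z::complex. z \<in> ball 0 1) (nhds 0)" by (intro eventually_nhds_in_open) auto
  then have "eventually (\<lambda>z. hadamard_upto n g z = eval_fps (hadamard_fps n g) z) (nhds 0)"
    by eventually_elim (use step in auto)
  then have "fps_expansion (hadamard_upto n g) 0 = fps_expansion (eval_fps (hadamard_fps n g)) 0"
    by (rule fps_expansion_cong)
  also have "\<dots> = hadamard_fps n g"
  proof -
    have "0 < fps_conv_radius (hadamard_fps n g)"
      using step by (intro less_le_trans[OF _ fps_conv_radius_hadamard_fps]) auto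
    then have "eval_fps (hadamard_fps n g) has_fps_expansion hadamard_fps n g" by (rule eval_fps_has_fps_expansion)
    then show ?thesis by (intro fps_ext) (simp add: fps_expansion_def fps_nth_fps_expansion)
  qed
  finally have "hadamard (hadamard_upto n g) (g (Suc n)) = eval_fps (hadamard_fps (Suc n) g)"
    by (simp add: hadamard_def hadamard_fps_def atLeastAtMostSuc_conv mult.commute)
  moreover have "hadamard_upto (Suc n) g = hadamard (hadamard_upto n g) (g (Suc n))"
    using step by (simp add: hadamard_upto_def)
  ultimately show ?case by simp
qed

lemma bounded_if_coefficients_summable:
  assumes h: "\<And>z. cmod z < 1 \<Longrightarrow> h z = eval_fps P z"
    and bound: "\<And>k. 0 < k \<Longrightarrow> cmod (fps_nth P k) \<le> B * real k powr (- s)" and "1 < s"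
  shows "\<not> unbounded_on_disk h"
proof -
  have "summable (\<lambda>k. B * real k powr (- s))"
    using \<open>1 < s\<close> by (intro summable_mult) (simp add: summable_real_powr_iff)
  then have sum: "summable (\<lambda>k. cmod (fps_nth P k))"
    by (rule summable_comparison_test_ev[rotated])
       (use bound in \<open>auto intro!: eventually_mono[OF eventually_gt_at_top[of 0]]\<close>)
  have "cmod (h z) \<le> (\<Sum>k. cmod (fps_nth P k))" if z: "cmod z < 1" for z
  proof -
    have le: "cmod (fps_nth P k * z ^ k) \<le> cmod (fps_nth P k)" for k
      using z by (simp add: norm_mult norm_power mult_left_le power_le_one)
    have "cmod (h z) = cmod (\<Sum>k. fps_nth P k * z ^ k)" by (simp add: h[OF z] eval_fps_def)
    also have "\<dots> \<le> (\<Sum>k. cmod (fps_nth P k))"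
      by (rule norm_suminf_le[OF le sum])
    finally show ?thesis .
  qed
  then show ?thesis by (auto simp: unbounded_on_disk_def intro!: boundedI)
qed

text \<open>
  On the radius ending at \<zeta> all terms of index k > 0 of the series, multiplied by c, lie in one
  wedge narrower than a half-plane.  Their real parts cannot cancel, so boundedness of h would
  bound the partial sums of the divergent series with terms k^(-s).
\<close>

lemma unbounded_if_coefficients_in_wedge:
  assumes h: "\<And>z. cmod z < 1 \<Longrightarrow> h z = eval_fps P z" and rad: "1 \<le> fps_conv_radius P"
    and c: "cmod c = 1" "cmod \<zeta> = 1"
    and wedge: "\<And>k. 0 < k \<Longrightarrow> c * \<zeta> ^ k * fps_nth P k \<in> wedge \<theta>" and \<theta>: "0 < cos \<theta>"
    and lower: "\<And>k. 0 < k \<Longrightarrow> A * real k powr (- s) \<le> cmod (fps_nth P k)" and "0 < A" "s < 1"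
  shows "unbounded_on_disk h"
proof (rule ccontr)
  assume "\<not> unbounded_on_disk h"
  then obtain M where M: "\<And>z. cmod z < 1 \<Longrightarrow> cmod (h z) \<le> M"
    unfolding unbounded_on_disk_def bounded_iff by (auto simp: Ball_def)
  define b where "b k = c * \<zeta> ^ k * fps_nth P k" for k
  have b_lower: "cos \<theta> * (A * real k powr (- s)) \<le> Re (b k)" if "0 < k" for k
  proof -
    have "cos \<theta> * (A * real k powr (- s)) \<le> cos \<theta> * cmod (fps_nth P k)"
      using lower[OF that] \<theta> by (intro mult_left_mono) auto
    also have "\<dots> = cos \<theta> * cmod (b k)" using c by (simp add: b_def norm_mult norm_power)
    also have "\<dots> \<le> Re (b k)" using wedge[OF that] by (simp add: wedge_def b_def)
    finally show ?thesis .
  qed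
  have partial_x: "(\<Sum>k\<in>{1..N}. cos \<theta> * (A * real k powr (- s)) * x ^ k) \<le> 2 * M" if x: "0 < x" "x < 1" for N x
  proof -
    have x1: "cmod (\<zeta> * of_real x) < 1" using x c by (simp add: norm_mult)
    have "ereal (cmod (\<zeta> * of_real x)) < fps_conv_radius P"
      using x1 rad by (metis ereal_less(3) less_le_trans)
    then have "(\<lambda>k. fps_nth P k * (\<zeta> * of_real x) ^ k) sums h (\<zeta> * of_real x)"
      unfolding h[OF x1] by (intro sums_eval_fps) auto
    from sums_Re[OF sums_mult[OF this, of c]]
    have sums: "(\<lambda>k. Re (b k) * x ^ k) sums Re (c * h (\<zeta> * of_real x))"
    proof (rule sums_cong[THEN iffD1, rotated])
      fix k
      have "c * (fps_nth P k * (\<zeta> * of_real x) ^ k) = of_real (x ^ k) * b k"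
        by (simp add: b_def power_mult_distrib mult_ac)
      then show "Re (c * (fps_nth P k * (\<zeta> * of_real x) ^ k)) = Re (b k) * x ^ k" by (simp add: mult.commute)
    qed
    have nonneg: "0 \<le> Re (b k)" if "0 < k" for k
      using b_lower[OF that] \<theta> \<open>0 < A\<close> by (intro order_trans[OF _ b_lower[OF that]]) auto
    have "(\<Sum>k\<in>{0..N}. Re (b k) * x ^ k) \<le> (\<Sum>k. Re (b k) * x ^ k)"
      using sums nonneg x by (intro sum_le_suminf) (auto simp: sums_iff)
    also have "\<dots> = Re (c * h (\<zeta> * of_real x))" using sums by (simp add: sums_iff)
    also have "\<dots> \<le> M"
      using complex_Re_le_cmod[of "c * h (\<zeta> * of_real x)"] M[OF x1] c by (simp add: norm_mult)
    finally have "Re (b 0) + (\<Sum>k\<in>{1..N}. Re (b k) * x ^ k) \<le> M"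
      by (simp add: sum.atLeast_Suc_atMost)
    moreover have "- Re (b 0) \<le> M"
    proof -
      have "- Re (b 0) \<le> cmod (b 0)" using abs_Re_le_cmod[of "b 0"] by linarith
      also have "\<dots> = cmod (h 0)" using c by (simp add: b_def norm_mult h eval_fps_at_0)
      also have "\<dots> \<le> M" by (intro M) simp
      finally show ?thesis .
    qed
    moreover have "(\<Sum>k\<in>{1..N}. cos \<theta> * (A * real k powr (- s)) * x ^ k) \<le> (\<Sum>k\<in>{1..N}. Re (b k) * x ^ k)"
      using b_lower x by (intro sum_mono mult_right_mono) auto
    ultimately show ?thesis by linarith
  qed
  have partial: "(\<Sum>k\<in>{1..N}. cos \<theta> * (A * real k powr (- s))) \<le> 2 * M" for N
  proof (rule tendsto_upperbound[of _ _ "at_left (1::real)"])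
    have "((\<lambda>x. \<Sum>k\<in>{1..N}. cos \<theta> * (A * real k powr (- s)) * x ^ k) \<longlongrightarrow>
       (\<Sum>k\<in>{1..N}. cos \<theta> * (A * real k powr (- s)) * 1 ^ k)) (at_left 1)"
      by (intro tendsto_intros)
    then show "((\<lambda>x. \<Sum>k\<in>{1..N}. cos \<theta> * (A * real k powr (- s)) * x ^ k) \<longlongrightarrow>
       (\<Sum>k\<in>{1..N}. cos \<theta> * (A * real k powr (- s)))) (at_left 1)" by simp
    show "eventually (\<lambda>x. (\<Sum>k\<in>{1..N}. cos \<theta> * (A * real k powr (- s)) * x ^ k) \<le> 2 * M) (at_left 1)"
      using eventually_at_left_real[of 0 1] by (simp, elim eventually_mono) (use partial_x in auto)
  qed simp
  have "summable (\<lambda>k. cos \<theta> * (A * real k powr (- s)))"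
  proof (rule summableI_nonneg_bounded)
    fix n
    have "(\<Sum>k<n. cos \<theta> * (A * real k powr (- s))) \<le> (\<Sum>k\<in>{0..n}. cos \<theta> * (A * real k powr (- s)))"
      using \<theta> \<open>0 < A\<close> by (intro sum_mono2) auto
    also have "\<dots> = (\<Sum>k\<in>{1..n}. cos \<theta> * (A * real k powr (- s)))"
      by (simp add: sum.atLeast_Suc_atMost)
    also have "\<dots> \<le> 2 * M" by (rule partial)
    finally show "(\<Sum>k<n. cos \<theta> * (A * real k powr (- s))) \<le> 2 * M" .
  qed (use \<theta> \<open>0 < A\<close> in auto)
  then have "summable (\<lambda>k. real k powr (- s))"
    using \<theta> \<open>0 < A\<close> by simp
  then show False using \<open>s < 1\<close> by (simp add: summable_real_powr_iff)
qed

text \<open>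
  Multiplying the coefficients of the factors adds the half-angles of their wedges and the
  exponents of their moduli.  With s = \<Sum> (1 - \<alpha> i), the coefficients of the product lie, after a
  rotation, in a wedge of half-angle about \<pi>s/2 and decay like k^(-s) up to arbitrarily small
  errors.  For s < 1 the wedge is narrower than a half-plane and the moduli are not summable;
  for s > 1 they are summable.
\<close>

theorem hadamard_product_dichotomy:
  assumes "1 \<le> n"
    and g: "\<And>i. i \<in> {1..n} \<Longrightarrow> convex_mapping (g i)"
    and angle: "\<And>i. i \<in> {1..n} \<Longrightarrow> mapping_angle_at_infinity (g i) = pi * \<alpha> i"
    and \<alpha>: "\<And>i. i \<in> {1..n} \<Longrightarrow> 0 < \<alpha> i" "\<And>i. i \<in> {1..n} \<Longrightarrow> \<alpha> i < 1"
  shows "(\<Sum>i\<in>{1..n}. 1 - \<alpha> i) < 1 \<Longrightarrow> unbounded_on_disk (hadamard_upto n g)"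
    and "1 < (\<Sum>i\<in>{1..n}. 1 - \<alpha> i) \<Longrightarrow> \<not> unbounded_on_disk (hadamard_upto n g)"
proof -
  define I where "I = {1..n}"
  define S where "S = (\<Sum>i\<in>I. 1 - \<alpha> i)"
  have I: "finite I" by (simp add: I_def)
  have hol: "g i holomorphic_on ball 0 1" if "i \<in> {1..n}" for i
    using g[OF that] by (simp add: convex_mapping_def)
  have h: "hadamard_upto n g z = eval_fps (hadamard_fps n g) z" if "cmod z < 1" for z
    using hadamard_upto_eq_eval_fps[OF \<open>1 \<le> n\<close> hol] that by simp
  note rad = fps_conv_radius_hadamard_fps[OF \<open>1 \<le> n\<close> hol]
  have nth: "fps_nth (hadamard_fps n g) k = (\<Prod>i\<in>I. fps_nth (fps_expansion (g i) 0) k)" for k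
    by (simp add: hadamard_fps_def I_def)
  have "\<exists>\<epsilon>>0. (\<forall>i\<in>I. \<epsilon> < \<alpha> i \<and> \<alpha> i + \<epsilon> < 1) \<and> real n * \<epsilon> < \<bar>1 - S\<bar>" if "S \<noteq> 1"
  proof -
    have "eventually (\<lambda>\<epsilon>. \<forall>i\<in>I. \<epsilon> < \<alpha> i \<and> \<epsilon> < 1 - \<alpha> i) (at_right 0)"
      using \<alpha> I by (intro eventually_ball_finite ballI eventually_conj order_tendstoD(2)[OF tendsto_ident_at])
        (auto simp: I_def)
    moreover have "eventually (\<lambda>\<epsilon>. \<epsilon> < \<bar>1 - S\<bar> / real n) (at_right 0)"
      using that \<open>1 \<le> n\<close> by (intro order_tendstoD(2)[OF tendsto_ident_at]) auto
    moreover have "eventually (\<lambda>\<epsilon>::real. 0 < \<epsilon>) (at_right 0)" by (rule eventually_at_right_less)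
    ultimately have "eventually (\<lambda>\<epsilon>. 0 < \<epsilon> \<and> (\<forall>i\<in>I. \<epsilon> < \<alpha> i \<and> \<epsilon> < 1 - \<alpha> i) \<and> \<epsilon> < \<bar>1 - S\<bar> / real n) (at_right 0)"
      by eventually_elim auto
    then obtain \<epsilon> where "0 < \<epsilon>" "\<forall>i\<in>I. \<epsilon> < \<alpha> i \<and> \<epsilon> < 1 - \<alpha> i" "\<epsilon> < \<bar>1 - S\<bar> / real n"
      using eventually_happens' trivial_limit_at_right_real by blast
    then show ?thesis using \<open>1 \<le> n\<close>
      by (intro exI[of _ \<epsilon>]) (auto simp: field_simps)
  qed
  note ex_\<epsilon> = this
  define P where "P \<epsilon> i c \<zeta> A B \<longleftrightarrow> cmod c = 1 \<and> cmod \<zeta> = 1 \<and> 0 < A \<and> (\<forall>k>0.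
      c * \<zeta> ^ k * fps_nth (fps_expansion (g i) 0) k \<in> wedge (pi * (1 - \<alpha> i + \<epsilon>) / 2) \<and>
      cmod (fps_nth (fps_expansion (g i) 0) k) \<le> B * real k powr (- (1 - \<alpha> i - \<epsilon>)) \<and>
      A * real k powr (- (1 - \<alpha> i + \<epsilon>)) \<le> cmod (fps_nth (fps_expansion (g i) 0) k))"
    for \<epsilon> i c \<zeta> and A B :: real
  have coeffs: "\<exists>c \<zeta> A B. P \<epsilon> i c \<zeta> A B"
    if "i \<in> I" "0 < \<epsilon>" "\<epsilon> < \<alpha> i" "\<alpha> i + \<epsilon> < 1" for i \<epsilon>
    using convex_mapping_coefficients[OF g angle that(2-4)] that(1) unfolding I_def P_def by metis
  have sum_up: "(\<Sum>i\<in>I. 1 - \<alpha> i + \<epsilon>) = S + real n * \<epsilon>" "(\<Sum>i\<in>I. 1 - \<alpha> i - \<epsilon>) = S - real n * \<epsilon>" for \<epsilon>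
    by (simp_all add: S_def I_def sum.distrib sum_subtractf)
  show "unbounded_on_disk (hadamard_upto n g)" if "(\<Sum>i\<in>{1..n}. 1 - \<alpha> i) < 1"
  proof -
    have "S < 1" using that by (simp add: S_def I_def)
    with ex_\<epsilon> obtain \<epsilon> where \<epsilon>: "0 < \<epsilon>" "\<And>i. i \<in> I \<Longrightarrow> \<epsilon> < \<alpha> i" "\<And>i. i \<in> I \<Longrightarrow> \<alpha> i + \<epsilon> < 1"
        "S + real n * \<epsilon> < 1" by auto
    obtain c \<zeta> A B where P: "\<And>i. i \<in> I \<Longrightarrow> P \<epsilon> i (c i) (\<zeta> i) (A i) (B i)"
      using coeffs[OF _ \<epsilon>(1) \<epsilon>(2,3)] by metis
    then have c: "\<And>i. i \<in> I \<Longrightarrow> cmod (c i) = 1" "\<And>i. i \<in> I \<Longrightarrow> cmod (\<zeta> i) = 1" "\<And>i. i \<in> I \<Longrightarrow> 0 < A i"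
      and w: "\<And>i k. i \<in> I \<Longrightarrow> 0 < k \<Longrightarrow> c i * \<zeta> i ^ k * fps_nth (fps_expansion (g i) 0) k \<in> wedge (pi * (1 - \<alpha> i + \<epsilon>) / 2)"
      and l: "\<And>i k. i \<in> I \<Longrightarrow> 0 < k \<Longrightarrow> A i * real k powr (- (1 - \<alpha> i + \<epsilon>)) \<le> cmod (fps_nth (fps_expansion (g i) 0) k)"
      by (simp_all add: P_def)
    define \<theta> where "\<theta> = (\<Sum>i\<in>I. pi * (1 - \<alpha> i + \<epsilon>) / 2)"
    have \<theta>_eq: "\<theta> = pi / 2 * (S + real n * \<epsilon>)"
      unfolding \<theta>_def sum_up(1)[symmetric] by (simp add: sum_distrib_left sum_divide_distrib)
    have "0 \<le> \<theta>"
      unfolding \<theta>_def using \<epsilon> \<alpha> by (intro sum_nonneg) (auto simp: I_def less_imp_le add_nonneg_pos)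
    have "\<theta> < pi / 2" unfolding \<theta>_eq using \<epsilon>(4) by simp
    show ?thesis
    proof (rule unbounded_if_coefficients_in_wedge[OF h rad])
      show "cmod (prod c I) = 1" "cmod (prod \<zeta> I) = 1" using c by (simp_all add: prod_norm[symmetric])
      show "0 < cos \<theta>" using \<open>0 \<le> \<theta>\<close> \<open>\<theta> < pi / 2\<close> by (intro cos_gt_zero_pi) auto
      show "0 < prod A I" using c by (intro prod_pos) auto
      show "S + real n * \<epsilon> < 1" by (rule \<epsilon>)
      fix k :: nat assume k: "0 < k"
      have "(\<Prod>i\<in>I. c i * \<zeta> i ^ k * fps_nth (fps_expansion (g i) 0) k) \<in> wedge \<theta>"
        unfolding \<theta>_def
      proof (rule wedge_prod[OF I w[OF _ k]])
        show "(\<Sum>i\<in>I. pi * (1 - \<alpha> i + \<epsilon>) / 2) \<le> pi" using \<open>\<theta> < pi / 2\<close> pi_gt_zero unfolding \<theta>_def by linarith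
      qed (use \<epsilon> \<alpha> in \<open>auto simp: I_def less_imp_le add_nonneg_pos\<close>)
      then show "prod c I * prod \<zeta> I ^ k * fps_nth (hadamard_fps n g) k \<in> wedge \<theta>"
        by (simp add: nth prod.distrib prod_power_distrib)
      have "prod A I * real k powr (- (S + real n * \<epsilon>)) = (\<Prod>i\<in>I. A i * real k powr (- (1 - \<alpha> i + \<epsilon>)))"
        unfolding sum_up(1)[symmetric] sum_negf[symmetric] using k by (simp add: prod.distrib powr_sum)
      also have "\<dots> \<le> (\<Prod>i\<in>I. cmod (fps_nth (fps_expansion (g i) 0) k))"
        using l k c by (intro prod_mono) (auto simp: less_imp_le)
      finally show "prod A I * real k powr (- (S + real n * \<epsilon>)) \<le> cmod (fps_nth (hadamard_fps n g) k)"
        by (simp add: nth prod_norm)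
    qed
  qed
  show "\<not> unbounded_on_disk (hadamard_upto n g)" if "1 < (\<Sum>i\<in>{1..n}. 1 - \<alpha> i)"
  proof -
    have "1 < S" using that by (simp add: S_def I_def)
    with ex_\<epsilon> obtain \<epsilon> where \<epsilon>: "0 < \<epsilon>" "\<And>i. i \<in> I \<Longrightarrow> \<epsilon> < \<alpha> i" "\<And>i. i \<in> I \<Longrightarrow> \<alpha> i + \<epsilon> < 1"
        "1 < S - real n * \<epsilon>" by auto
    obtain c \<zeta> A B where P: "\<And>i. i \<in> I \<Longrightarrow> P \<epsilon> i (c i) (\<zeta> i) (A i) (B i)"
      using coeffs[OF _ \<epsilon>(1) \<epsilon>(2,3)] by metis
    then have u: "\<And>i k. i \<in> I \<Longrightarrow> 0 < k \<Longrightarrow> cmod (fps_nth (fps_expansion (g i) 0) k) \<le> B i * real k powr (- (1 - \<alpha> i - \<epsilon>))"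
      by (simp add: P_def)
    show ?thesis
    proof (rule bounded_if_coefficients_summable[OF h _ \<epsilon>(4)])
      fix k :: nat assume k: "0 < k"
      have "cmod (fps_nth (hadamard_fps n g) k) = (\<Prod>i\<in>I. cmod (fps_nth (fps_expansion (g i) 0) k))"
        by (simp add: nth prod_norm)
      also have "\<dots> \<le> (\<Prod>i\<in>I. B i * real k powr (- (1 - \<alpha> i - \<epsilon>)))"
        using u k by (intro prod_mono) auto
      also have "\<dots> = prod B I * real k powr (- (S - real n * \<epsilon>))"
        unfolding sum_up(2)[symmetric] sum_negf[symmetric] using k by (simp add: prod.distrib powr_sum)
      finally show "cmod (fps_nth (hadamard_fps n g) k) \<le> prod B I * real k powr (- (S - real n * \<epsilon>))" .
    qed
  qed
qed

section \<open>Uniformly distributed angles\<close>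

text \<open>
  The closed simplices of size t < 1 have volume t^n / n! and lie in the open one, which in turn
  lies in the closed simplex of size 1.  Letting t tend to 1 shows that the face has measure 0.
\<close>

lemma emeasure_open_unit_simplex:
  assumes "finite I"
  defines "L \<equiv> \<Pi>\<^sub>M i\<in>I. (lborel :: real measure)"
  shows "emeasure L {x \<in> space L. (\<forall>i\<in>I. 0 \<le> x i) \<and> sum x I < 1} = ennreal (1 / fact (card I))"
    and "{x \<in> space L. (\<forall>i\<in>I. 0 \<le> x i) \<and> sum x I = 1} \<in> null_sets L"
proof -
  define S where "S t = {x \<in> space L. (\<forall>i\<in>I. 0 \<le> x i) \<and> sum x I \<le> t}" for t :: real
  define U where "U = {x \<in> space L. (\<forall>i\<in>I. 0 \<le> x i) \<and> sum x I < 1}"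
  define T where "T = {x \<in> space L. (\<forall>i\<in>I. 0 \<le> x i) \<and> sum x I = 1}"
  have meas: "S t \<in> sets L" "U \<in> sets L" "T \<in> sets L" for t
    using \<open>finite I\<close> unfolding S_def U_def T_def L_def by measurable
  have S: "emeasure L (S t) = ennreal (t ^ card I / fact (card I))" if "0 \<le> t" for t
  proof -
    have "S t = {x. (\<forall>i\<in>I. 0 \<le> x i) \<and> sum x I \<le> t} \<inter> space L" by (auto simp: S_def)
    then show ?thesis using emeasure_std_simplex_aux[OF \<open>finite I\<close> that] by (simp add: L_def)
  qed
  have U: "emeasure L U = ennreal (1 / fact (card I))"
  proof (rule antisym)
    have "U \<subseteq> S 1" by (auto simp: S_def U_def)
    from emeasure_mono[OF this meas(1)] have "emeasure L U \<le> emeasure L (S 1)" .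
    then show "emeasure L U \<le> ennreal (1 / fact (card I))" by (simp add: S)
    show "ennreal (1 / fact (card I)) \<le> emeasure L U"
    proof (rule tendsto_upperbound[of _ _ "at_left (1::real)"])
      have "((\<lambda>t. ennreal (t ^ card I / fact (card I))) \<longlongrightarrow> ennreal (1 ^ card I / fact (card I))) (at_left 1)"
        by (intro tendsto_intros tendsto_ennrealI) auto
      then show "((\<lambda>t. ennreal (t ^ card I / fact (card I))) \<longlongrightarrow> ennreal (1 / fact (card I))) (at_left 1)"
        by simp
      have "ennreal (t ^ card I / fact (card I)) \<le> emeasure L U" if "0 < t" "t < 1" for t
      proof -
        have "S t \<subseteq> U" using that by (auto simp: S_def U_def)
        from emeasure_mono[OF this meas(2)] have "emeasure L (S t) \<le> emeasure L U" .
        then show ?thesis using that by (simp add: S)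
      qed
      then show "eventually (\<lambda>t. ennreal (t ^ card I / fact (card I)) \<le> emeasure L U) (at_left 1)"
        using eventually_at_left_real[of 0 1] by (simp, elim eventually_mono) auto
    qed simp
  qed
  then show "emeasure L {x \<in> space L. (\<forall>i\<in>I. 0 \<le> x i) \<and> sum x I < 1} = ennreal (1 / fact (card I))"
    by (simp add: U_def)
  have "T = S 1 - U" by (auto simp: S_def U_def T_def)
  moreover have "emeasure L (S 1 - U) = emeasure L (S 1) - emeasure L U"
    by (intro emeasure_Diff meas) (simp add: U, auto simp: S_def U_def)
  ultimately have "emeasure L T = 0" by (simp add: S U)
  then show "{x \<in> space L. (\<forall>i\<in>I. 0 \<le> x i) \<and> sum x I = 1} \<in> null_sets L"
    unfolding T_def[symmetric] using meas by auto
qed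

lemma lborel_distr_reflect: "distr lborel lborel (\<lambda>x::real. 1 - x) = lborel"
  using lborel_real_affine[of "-1" 1] by (simp add: density_1 cong: distr_cong)

text \<open>
  The reflection 1 - x in each coordinate is used to pass from the corner of the cube at
  (1, ..., 1) to the standard simplex at the origin.
\<close>

lemma PiM_lborel_distr_reflect:
  assumes "finite I"
  shows "distr (\<Pi>\<^sub>M i\<in>I. (lborel :: real measure)) (\<Pi>\<^sub>M i\<in>I. lborel) (\<lambda>x. \<lambda>i\<in>I. 1 - x i) = (\<Pi>\<^sub>M i\<in>I. lborel)"
proof -
  interpret product_sigma_finite "\<lambda>_. lborel :: real measure"
    by standard
  show ?thesis
  proof (rule PiM_eqI[OF \<open>finite I\<close>, symmetric, unfolded eq_commute[of "PiM _ _"]])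
    show "sets (distr (\<Pi>\<^sub>M i\<in>I. lborel) (\<Pi>\<^sub>M i\<in>I. lborel) (\<lambda>x. \<lambda>i\<in>I. 1 - x i)) = sets (\<Pi>\<^sub>M i\<in>I. lborel :: real measure)"
      by simp
    fix A :: "'a \<Rightarrow> real set" assume A: "\<And>i. i \<in> I \<Longrightarrow> A i \<in> sets lborel"
    define B where "B i = (\<lambda>x. 1 - x) -` A i \<inter> space lborel" for i
    have B: "B i \<in> sets lborel" if "i \<in> I" for i
      unfolding B_def using A[OF that] by measurable
    have "emeasure (distr (\<Pi>\<^sub>M i\<in>I. lborel) (\<Pi>\<^sub>M i\<in>I. lborel) (\<lambda>x. \<lambda>i\<in>I. 1 - x i)) (Pi\<^sub>E I A)
      = emeasure (\<Pi>\<^sub>M i\<in>I. lborel) ((\<lambda>x. \<lambda>i\<in>I. 1 - x i) -` Pi\<^sub>E I A \<inter> space (\<Pi>\<^sub>M i\<in>I. lborel))"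
      using A \<open>finite I\<close> by (intro emeasure_distr) (auto intro!: sets_PiM_I_finite)
    also have "(\<lambda>x. \<lambda>i\<in>I. 1 - x i) -` Pi\<^sub>E I A \<inter> space (\<Pi>\<^sub>M i\<in>I. lborel) = Pi\<^sub>E I B"
      by (auto simp: B_def space_PiM PiE_iff)
    also have "emeasure (\<Pi>\<^sub>M i\<in>I. lborel) (Pi\<^sub>E I B) = (\<Prod>i\<in>I. emeasure lborel (B i))"
      using B by (intro emeasure_PiM \<open>finite I\<close>) auto
    also have "\<dots> = (\<Prod>i\<in>I. emeasure lborel (A i))"
    proof (rule prod.cong[OF refl])
      fix i assume "i \<in> I"
      then have "emeasure (distr lborel lborel (\<lambda>x::real. 1 - x)) (A i) = emeasure lborel (B i)"
        unfolding B_def using A by (intro emeasure_distr) auto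
      then show "emeasure lborel (B i) = emeasure lborel (A i)" by (simp add: lborel_distr_reflect)
    qed
    finally show "emeasure (distr (\<Pi>\<^sub>M i\<in>I. lborel) (\<Pi>\<^sub>M i\<in>I. lborel) (\<lambda>x. \<lambda>i\<in>I. 1 - x i)) (Pi\<^sub>E I A)
        = (\<Prod>i\<in>I. emeasure lborel (A i))" .
  qed
qed

lemma emeasure_uniform_cube:
  assumes "A \<in> sets (\<Pi>\<^sub>M i\<in>{1..n}. (lborel :: real measure))"
  shows "emeasure (uniform_cube n) A = emeasure (\<Pi>\<^sub>M i\<in>{1..n}. lborel) ((Pi\<^sub>E {1..n} (\<lambda>_. {0..1})) \<inter> A)"
proof -
  interpret product_sigma_finite "\<lambda>_. lborel :: real measure" by standard
  have "emeasure (\<Pi>\<^sub>M i\<in>{1..n}. lborel) (Pi\<^sub>E {1..n} (\<lambda>_. {0..1::real})) = 1"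
    by (subst emeasure_PiM) auto
  then show ?thesis
    unfolding uniform_cube_def using assms
    by (subst emeasure_uniform_measure) (auto intro!: sets_PiM_I_finite simp: divide_ennreal_def)
qed

lemma cube_coordinate_null:
  fixes n :: nat
  assumes "i \<in> {1..n}"
  shows "Pi\<^sub>E {1..n} (\<lambda>_. {0..1}) \<inter> {x \<in> space (\<Pi>\<^sub>M i\<in>{1..n}. (lborel :: real measure)). x i = c}
    \<in> null_sets (\<Pi>\<^sub>M i\<in>{1..n}. lborel)"
proof -
  interpret product_sigma_finite "\<lambda>_. lborel :: real measure" by standard
  define A where "A = Pi\<^sub>E {1..n} (\<lambda>j. if j = i then {c} else {0..1::real})"
  have "emeasure (\<Pi>\<^sub>M i\<in>{1..n}. lborel) A = (\<Prod>j\<in>{1..n}. emeasure lborel (if j = i then {c} else {0..1::real}))"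
    unfolding A_def by (intro emeasure_PiM) auto
  also have "\<dots> = 0" using assms by (intro prod_zero) auto
  finally have A: "A \<in> null_sets (\<Pi>\<^sub>M i\<in>{1..n}. lborel)"
    unfolding A_def by (intro null_setsI sets_PiM_I_finite) auto
  show ?thesis
  proof (rule null_sets_subset[OF A])
    show "Pi\<^sub>E {1..n} (\<lambda>_. {0..1}) \<inter> {x \<in> space (\<Pi>\<^sub>M i\<in>{1..n}. (lborel :: real measure)). x i = c}
       \<in> sets (\<Pi>\<^sub>M i\<in>{1..n}. lborel)"
      using assms by (intro sets.Int sets_PiM_I_finite) auto
    show "Pi\<^sub>E {1..n} (\<lambda>_. {0..1}) \<inter> {x \<in> space (\<Pi>\<^sub>M i\<in>{1..n}. (lborel :: real measure)). x i = c} \<subseteq> A"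
      by (auto simp: A_def PiE_iff)
  qed
qed

text \<open>
  In the coordinates 1 - x i the event is the open unit simplex, and the exceptional set consists
  of its face and of finitely many slices of the cube.
\<close>

lemma uniform_cube_deficit_sum:
  fixes n :: nat
  defines "L \<equiv> \<Pi>\<^sub>M i\<in>{1..n}. (lborel :: real measure)"
  shows "emeasure (uniform_cube n) {x \<in> space L. (\<Sum>i\<in>{1..n}. 1 - x i) < 1} = ennreal (1 / fact n)"
    and "AE x in uniform_cube n. (\<forall>i\<in>{1..n}. 0 < x i \<and> x i < 1) \<and> (\<Sum>i\<in>{1..n}. 1 - x i) \<noteq> 1"
proof -
  define I where "I = {1..n}"
  define Q where "Q = Pi\<^sub>E I (\<lambda>_. {0..1::real})"
  define \<rho> where "\<rho> x = (\<lambda>i\<in>I. 1 - x i :: real)" for x :: "nat \<Rightarrow> real"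
  have L: "L = (\<Pi>\<^sub>M i\<in>I. lborel)" by (simp add: L_def I_def)
  have [simp]: "finite I" by (simp add: I_def)
  have \<rho>_meas: "\<rho> \<in> measurable L L" unfolding \<rho>_def L by measurable
  have reflect: "emeasure L (\<rho> -` A \<inter> space L) = emeasure L A" if "A \<in> sets L" for A
  proof -
    have "emeasure (distr L L \<rho>) A = emeasure L (\<rho> -` A \<inter> space L)"
      using \<rho>_meas that by (rule emeasure_distr)
    then show ?thesis unfolding L \<rho>_def using PiM_lborel_distr_reflect[of I] by simp
  qed
  have Q: "Q \<in> sets L" unfolding Q_def L by (intro sets_PiM_I_finite) auto
  have sum_\<rho>: "sum (\<rho> x) I = (\<Sum>i\<in>I. 1 - x i)" for x by (simp add: \<rho>_def)
  define G where "G = {x \<in> space L. (\<Sum>i\<in>I. 1 - x i) < 1}"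
  define T where "T = {x \<in> space L. (\<Sum>i\<in>I. 1 - x i) = 1}"
  have G: "G \<in> sets L" and T: "T \<in> sets L" unfolding G_def T_def L by measurable
  define U where "U = {x \<in> space L. (\<forall>i\<in>I. 0 \<le> x i) \<and> sum x I < 1}"
  define V where "V = {x \<in> space L. (\<forall>i\<in>I. 0 \<le> x i) \<and> sum x I = 1}"
  have U: "U \<in> sets L" and V: "V \<in> sets L" unfolding U_def V_def L by measurable
  have small: "x i \<le> 1" if "\<forall>i\<in>I. 0 \<le> x i" "sum x I \<le> 1" "i \<in> I" for x :: "nat \<Rightarrow> real" and i
    using member_le_sum[of i I x] that by simp
  have pull: "x \<in> Q \<longleftrightarrow> (\<forall>i\<in>I. 0 \<le> \<rho> x i \<and> \<rho> x i \<le> 1)" if "x \<in> space L" for x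
    using that by (auto simp: Q_def \<rho>_def L space_PiM PiE_iff)
  have \<rho>_space: "\<rho> x \<in> space L" if "x \<in> space L" for x using measurable_space[OF \<rho>_meas that] .
  have QL: "Q \<subseteq> space L" using Q by (rule sets.sets_into_space)
  have "Q \<inter> G = \<rho> -` U \<inter> space L"
    using QL pull \<rho>_space small[of "\<rho> _"] unfolding G_def U_def sum_\<rho>[symmetric] by fastforce
  moreover have "emeasure (uniform_cube n) G = emeasure L (Q \<inter> G)"
    using emeasure_uniform_cube[of G n] G unfolding L I_def Q_def by simp
  moreover have "emeasure L U = ennreal (1 / fact n)"
    using emeasure_open_unit_simplex(1)[of I] unfolding U_def L by (simp add: I_def)
  ultimately show "emeasure (uniform_cube n) {x \<in> space L. (\<Sum>i\<in>{1..n}. 1 - x i) < 1} = ennreal (1 / fact n)"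
    using reflect[OF U] by (simp add: G_def I_def)
  have "Q \<inter> T = \<rho> -` V \<inter> space L"
    using QL pull \<rho>_space small[of "\<rho> _"] unfolding T_def V_def sum_\<rho>[symmetric] by fastforce
  moreover have "emeasure L V = 0"
    using emeasure_open_unit_simplex(2)[of I] unfolding V_def L by auto
  ultimately have "emeasure L (Q \<inter> T) = 0" using reflect[OF V] by simp
  then have QT: "Q \<inter> T \<in> null_sets L" using Q T by (intro null_setsI sets.Int)
  define N where "N = (space L - Q) \<union> T \<union> (\<Union>i\<in>I. {x \<in> space L. x i = 0} \<union> {x \<in> space L. x i = 1})"
  have N: "N \<in> sets L" unfolding N_def using Q T by (intro sets.Un sets.Diff sets.top sets.finite_UN) (auto simp: L)
  have "Q \<inter> T \<union> (\<Union>i\<in>I. Q \<inter> {x \<in> space L. x i = 0} \<union> Q \<inter> {x \<in> space L. x i = 1}) \<in> null_sets L"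
    using cube_coordinate_null[of _ n] QT unfolding Q_def L I_def by (intro null_sets.Un null_sets.finite_UN) auto
  moreover have "Q \<inter> N = Q \<inter> T \<union> (\<Union>i\<in>I. Q \<inter> {x \<in> space L. x i = 0} \<union> Q \<inter> {x \<in> space L. x i = 1})"
    by (auto simp: N_def)
  ultimately have "emeasure L (Q \<inter> N) = 0" by auto
  then have "emeasure (uniform_cube n) N = 0"
    using emeasure_uniform_cube[of N n] N unfolding L I_def Q_def by simp
  moreover have "sets (uniform_cube n) = sets L" "space (uniform_cube n) = space L"
    by (simp_all add: uniform_cube_def L_def)
  ultimately have "N \<in> null_sets (uniform_cube n)" using N by auto
  then show "AE x in uniform_cube n. (\<forall>i\<in>{1..n}. 0 < x i \<and> x i < 1) \<and> (\<Sum>i\<in>{1..n}. 1 - x i) \<noteq> 1"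
  proof (rule AE_I')
    show "{x \<in> space (uniform_cube n). \<not> ((\<forall>i\<in>{1..n}. 0 < x i \<and> x i < 1) \<and> (\<Sum>i\<in>{1..n}. 1 - x i) \<noteq> 1)} \<subseteq> N"
    proof (clarify, rule ccontr)
      fix x assume x: "x \<in> space (uniform_cube n)" "x \<notin> N"
        and not: "\<not> ((\<forall>i\<in>{1..n}. 0 < x i \<and> x i < 1) \<and> (\<Sum>i\<in>{1..n}. 1 - x i) \<noteq> 1)"
      have xL: "x \<in> space L" using x(1) by (simp add: uniform_cube_def L_def)
      have Q: "x \<in> Q" and T: "x \<notin> T" and ne: "\<And>i. i \<in> I \<Longrightarrow> x i \<noteq> 0 \<and> x i \<noteq> 1"
        using x(2) xL by (auto simp: N_def)
      have "0 < x i \<and> x i < 1" if "i \<in> I" for i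
        using Q ne[OF that] that by (auto simp: Q_def PiE_iff less_le)
      moreover have "(\<Sum>i\<in>I. 1 - x i) \<noteq> 1" using T xL by (simp add: T_def)
      ultimately show False using not unfolding I_def by blast
    qed
  qed
qed

text \<open>
  The event differs from the preimage under \<alpha> of the region s < 1 only inside a null set.  As the
  mappings may depend on the sample point in a nonmeasurable way, so may the difference, which
  is why the event is measurable only for the completed measure.
\<close>

theorem corollary3p3:
  fixes n :: nat
    and M :: "'w measure"
    and \<alpha> :: "'w \<Rightarrow> nat \<Rightarrow> real"
    and g :: "'w \<Rightarrow> nat \<Rightarrow> complex \<Rightarrow> complex"
  assumes "n \<ge> 1"
    and "prob_space M"
    and "\<alpha> \<in> measurable M (Pi\<^sub>M {1..n} (\<lambda>_. lborel))"
    and "distr M (Pi\<^sub>M {1..n} (\<lambda>_. lborel)) \<alpha> = uniform_cube n"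
    and "\<And>\<omega> i. \<omega> \<in> space M \<Longrightarrow> i \<in> {1..n} \<Longrightarrow> unbounded_convex_mapping (g \<omega> i)"
    and "\<And>\<omega> i. \<omega> \<in> space M \<Longrightarrow> i \<in> {1..n} \<Longrightarrow>
           mapping_angle_at_infinity (g \<omega> i) = pi * \<alpha> \<omega> i"
  shows "{\<omega> \<in> space M. unbounded_on_disk (hadamard_upto n (g \<omega>))} \<in> sets (completion M) \<and>
         measure (completion M) {\<omega> \<in> space M. unbounded_on_disk (hadamard_upto n (g \<omega>))}
           = 1 / fact n"
proof -
  interpret prob_space M by fact
  define L where "L = (\<Pi>\<^sub>M i\<in>{1..n}. (lborel :: real measure))"
  define E where "E = {\<omega> \<in> space M. unbounded_on_disk (hadamard_upto n (g \<omega>))}"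
  define D where "D = {x \<in> space L. (\<Sum>i\<in>{1..n}. 1 - x i) < 1}"
  define G where "G = \<alpha> -` D \<inter> space M"
  have \<alpha>: "\<alpha> \<in> measurable M L" using assms(3) by (simp add: L_def)
  have distr: "distr M L \<alpha> = uniform_cube n" using assms(4) by (simp add: L_def)
  have D: "D \<in> sets L" unfolding D_def L_def by measurable
  have G: "G \<in> sets M" unfolding G_def using \<alpha> D by (rule measurable_sets)
  have "emeasure M G = emeasure (uniform_cube n) D"
    unfolding distr[symmetric] G_def using \<alpha> D by (rule emeasure_distr[symmetric])
  also have "\<dots> = ennreal (1 / fact n)"
    using uniform_cube_deficit_sum(1)[of n] by (simp add: D_def L_def)
  finally have "measure M G = 1 / fact n"
    by (simp add: measure_def)
  have "AE \<omega> in M. (\<forall>i\<in>{1..n}. 0 < \<alpha> \<omega> i \<and> \<alpha> \<omega> i < 1) \<and> (\<Sum>i\<in>{1..n}. 1 - \<alpha> \<omega> i) \<noteq> 1"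
    using AE_distrD[OF \<alpha>] uniform_cube_deficit_sum(2)[of n] unfolding distr[symmetric] by blast
  then obtain N where N: "N \<in> null_sets M"
    and generic: "\<forall>\<omega>\<in>space M - N.
      (\<forall>i\<in>{1..n}. 0 < \<alpha> \<omega> i \<and> \<alpha> \<omega> i < 1) \<and> (\<Sum>i\<in>{1..n}. 1 - \<alpha> \<omega> i) \<noteq> 1"
    by (elim AE_E3) blast
  have E_iff_G: "\<omega> \<in> E \<longleftrightarrow> \<omega> \<in> G" if \<omega>: "\<omega> \<in> space M" "\<omega> \<notin> N" for \<omega>
  proof -
    have \<alpha>\<omega>: "\<And>i. i \<in> {1..n} \<Longrightarrow> 0 < \<alpha> \<omega> i" "\<And>i. i \<in> {1..n} \<Longrightarrow> \<alpha> \<omega> i < 1" "(\<Sum>i\<in>{1..n}. 1 - \<alpha> \<omega> i) \<noteq> 1"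
      using generic \<omega> by blast+
    have cvx: "convex_mapping (g \<omega> i)" if "i \<in> {1..n}" for i
      using assms(5)[OF \<omega>(1) that] by (simp add: unbounded_convex_mapping_def)
    have "unbounded_on_disk (hadamard_upto n (g \<omega>)) \<longleftrightarrow> (\<Sum>i\<in>{1..n}. 1 - \<alpha> \<omega> i) < 1"
    proof (cases "(\<Sum>i\<in>{1..n}. 1 - \<alpha> \<omega> i) < 1")
      case True
      have "unbounded_on_disk (hadamard_upto n (g \<omega>))"
        by (rule hadamard_product_dichotomy(1)[where g = "g \<omega>" and \<alpha> = "\<alpha> \<omega>"])
           (fact assms(1) cvx assms(6)[OF \<omega>(1)] \<alpha>\<omega>(1,2) True)+
      with True show ?thesis by blast
    next
      case False
      with \<alpha>\<omega>(3) have greater: "1 < (\<Sum>i\<in>{1..n}. 1 - \<alpha> \<omega> i)" by linarith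
      have "\<not> unbounded_on_disk (hadamard_upto n (g \<omega>))"
        by (rule hadamard_product_dichotomy(2)[where g = "g \<omega>" and \<alpha> = "\<alpha> \<omega>"])
           (fact assms(1) cvx assms(6)[OF \<omega>(1)] \<alpha>\<omega>(1,2) greater)+
      with False show ?thesis by blast
    qed
    then show ?thesis
      using \<omega>(1) measurable_space[OF \<alpha> \<omega>(1)] by (simp add: E_def G_def D_def)
  qed
  have "E = (G - N) \<union> (E \<inter> N)"
    using E_iff_G sets.sets_into_space[OF G] by (auto simp: E_def)
  then have E: "E \<in> sets (completion M)"
    using G N by (intro sets_completionI[of E "G - N" "E \<inter> N" N]) auto
  have "AE \<omega> in completion M. \<omega> \<notin> N"
    using N by (intro AE_completion AE_not_in)
  then have "AE \<omega> in completion M. \<omega> \<in> E \<longleftrightarrow> \<omega> \<in> G"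
    using AE_space by eventually_elim (simp add: E_iff_G)
  then have "measure (completion M) E = measure (completion M) G"
    using E G by (intro measure_eq_AE) auto
  also have "\<dots> = 1 / fact n"
    using G \<open>measure M G = 1 / fact n\<close> by simp
  finally show ?thesis using E unfolding E_def by blast
qed

end
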